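(* Consider the following non-clairvoyant policy for preemptive scheduling of precedence-constrained jobs on $m$ identical parallel machines: at time $0$ and at each of the first $n-1$ job completion times $t$, compute processing rates by Algorithm 2 (described in the context) and keep these rates constant until the next job completion. This policy is $3$-competitive for minimizing the total weighted completion time, i.e., for every instance, the schedule $\mathrm{ALG}$ it produces satisfies $\sum_{j=1}^n w_j C_j^{\mathrm{ALG}} \le 3 \sum_{j=1}^n w_j C_j^{\mathrm{OPT}}$, where $\mathrm{OPT}$ is an optimal preemptive schedule on the $m$ machines computed with full knowledge of all processing times.
   Context: An instance consists of $m$ identical machines and jobs $N=\{1,\dots,n\}$ with processing times $p_j\ge 0$, weights $w_j\ge 0$, and precedence constraints $A\subseteq N\times N$ with $(N,A)$ acyclic; $(k,j)\in A$ means $k$ must complete before $j$ may be processed. A schedule assigns to each job $j$ at each time $t\ge0$ a rate $R_j(t)\in[0,1]$ with $\sum_j R_j(t)\le m$, where only available jobs (unfinished jobs all of whose predecessors are completed) receive positive rate. $Y_j(t)=\int_0^tR_j(s)\,ds$, $C_j=\min\{t: Y_j(t)\ge p_j\}$, objective $\sum_j w_jC_j$. Non-clairvoyant: weights and precedences are known initially, $p_j$ is revealed only at completion of $j$. At time $t$, $U_t$ denotes the unfinished jobs and $F_t\subseteq U_t$ the available jobs. Define the digraph $D_t=(\mathcal V_t,\mathcal A_t)$ with $\mathcal V_t=U_t\cup\{\mathrm A,\mathrm B,\mathrm Z\}$ and arcs $\{(j,k)\in A: j,k\in U_t\}\cup\{(\mathrm A,\mathrm B)\}\cup\{(\mathrm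 B,j): j\in F_t\}\cup\{(j,\mathrm Z): j\in U_t\}$, with capacities depending on a parameter $\pi>0$: $u_{(\mathrm A,\mathrm B)}(\pi)=m$, $u_{(\mathrm B,j)}(\pi)=1$, $u_{(j,k)}(\pi)=\infty$ for precedence arcs, $u_{(j,\mathrm Z)}(\pi)=w_j/\pi$. Algorithm 2 (rates at time $t$): if $|F_t|\le m$, set $R_j(t)=1$ for all $j\in F_t$; otherwise compute $\pi_t=\max\{\pi>0: (\{\mathrm A\},\mathcal V_t\setminus\{\mathrm A\})$ is a minimum-capacity $\mathrm A$-$\mathrm Z$-cut w.r.t. $u(\pi)\}$, let $x^t$ be a maximum $\mathrm A$-$\mathrm Z$-flow for capacities $u(\pi_t)$, and set $R_j(t)=x^t_{(\mathrm B,j)}$ for all $j\in F_t$. *)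

theory Defs
  imports "HOL-Analysis.Analysis"
begin

subsection \<open>Cuts and flows in capacitated digraphs\<close>

definition is_cut :: "'v set \<Rightarrow> 'v \<Rightarrow> 'v \<Rightarrow> 'v set \<Rightarrow> bool" where
  "is_cut V s t S \<longleftrightarrow> S \<subseteq> V \<and> s \<in> S \<and> t \<notin> S"

definition cut_capacity :: "('v \<times> 'v) set \<Rightarrow> ('v \<times> 'v \<Rightarrow> ereal) \<Rightarrow> 'v set \<Rightarrow> ereal" where
  "cut_capacity E u S = (\<Sum>e \<in> {e \<in> E. fst e \<in> S \<and> snd e \<notin> S}. u e)"

definition is_min_cut ::
  "'v set \<Rightarrow> ('v \<times> 'v) set \<Rightarrow> ('v \<times> 'v \<Rightarrow> ereal) \<Rightarrow> 'v \<Rightarrow> 'v \<Rightarrow> 'v set \<Rightarrow> bool" where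
  "is_min_cut V E u s t S \<longleftrightarrow> is_cut V s t S \<and>
     (\<forall>S'. is_cut V s t S' \<longrightarrow> cut_capacity E u S \<le> cut_capacity E u S')"

definition outflow :: "('v \<times> 'v) set \<Rightarrow> ('v \<times> 'v \<Rightarrow> real) \<Rightarrow> 'v \<Rightarrow> real" where
  "outflow E x v = (\<Sum>e \<in> {e \<in> E. fst e = v}. x e)"

definition inflow :: "('v \<times> 'v) set \<Rightarrow> ('v \<times> 'v \<Rightarrow> real) \<Rightarrow> 'v \<Rightarrow> real" where
  "inflow E x v = (\<Sum>e \<in> {e \<in> E. snd e = v}. x e)"

definition is_flow ::
  "'v set \<Rightarrow> ('v \<times> 'v) set \<Rightarrow> ('v \<times> 'v \<Rightarrow> ereal) \<Rightarrow> 'v \<Rightarrow> 'v \<Rightarrow> ('v \<times> 'v \<Rightarrow> real) \<Rightarrow> bool" where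
  "is_flow V E u s t x \<longleftrightarrow>
     (\<forall>e \<in> E. 0 \<le> x e \<and> ereal (x e) \<le> u e) \<and>
     (\<forall>v \<in> V - {s, t}. inflow E x v = outflow E x v)"

definition flow_value :: "('v \<times> 'v) set \<Rightarrow> 'v \<Rightarrow> ('v \<times> 'v \<Rightarrow> real) \<Rightarrow> real" where
  "flow_value E s x = outflow E x s - inflow E x s"

definition is_max_flow ::
  "'v set \<Rightarrow> ('v \<times> 'v) set \<Rightarrow> ('v \<times> 'v \<Rightarrow> ereal) \<Rightarrow> 'v \<Rightarrow> 'v \<Rightarrow> ('v \<times> 'v \<Rightarrow> real) \<Rightarrow> bool" where
  "is_max_flow V E u s t x \<longleftrightarrow> is_flow V E u s t x \<and>
     (\<forall>y. is_flow V E u s t y \<longrightarrow> flow_value E s y \<le> flow_value E s x)"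


subsection \<open>Instances and schedules\<close>

definition scheduling_instance ::
  "nat \<Rightarrow> nat \<Rightarrow> (nat \<Rightarrow> real) \<Rightarrow> (nat \<Rightarrow> real) \<Rightarrow> (nat \<times> nat) set \<Rightarrow> bool" where
  "scheduling_instance n m p w A \<longleftrightarrow>
     m \<ge> 1 \<and> (\<forall>j \<in> {1..n}. 0 \<le> p j \<and> 0 \<le> w j) \<and>
     A \<subseteq> {1..n} \<times> {1..n} \<and> acyclic A"

text \<open>\<open>R j t\<close> is the rate of job \<open>j\<close> at time \<open>t \<ge> 0\<close>; \<open>work R j t\<close> is the amount
  of processing \<open>Y\<^sub>j(t)\<close> that it has received up to time \<open>t\<close>.\<close>

definition work :: "(nat \<Rightarrow> real \<Rightarrow> real) \<Rightarrow> nat \<Rightarrow> real \<Rightarrow> real" where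
  "work R j t = integral {0..t} (R j)"

definition unfinished :: "nat \<Rightarrow> (nat \<Rightarrow> real) \<Rightarrow> (nat \<Rightarrow> real \<Rightarrow> real) \<Rightarrow> real \<Rightarrow> nat set" where
  "unfinished n p R t = {j \<in> {1..n}. work R j t < p j}"

definition available :: "(nat \<times> nat) set \<Rightarrow> nat set \<Rightarrow> nat set" where
  "available A U = {j \<in> U. \<forall>k. (k, j) \<in> A \<longrightarrow> k \<notin> U}"

definition schedule ::
  "nat \<Rightarrow> nat \<Rightarrow> (nat \<Rightarrow> real) \<Rightarrow> (nat \<times> nat) set \<Rightarrow> (nat \<Rightarrow> real \<Rightarrow> real) \<Rightarrow> bool" where
  "schedule n m p A R \<longleftrightarrow>
     (\<forall>j \<in> {1..n}. \<forall>t \<ge> 0. R j integrable_on {0..t}) \<and>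
     (\<forall>j \<in> {1..n}. \<forall>t \<ge> 0. 0 \<le> R j t \<and> R j t \<le> 1) \<and>
     (\<forall>t \<ge> 0. (\<Sum>j = 1..n. R j t) \<le> real m) \<and>
     (\<forall>j \<in> {1..n}. \<forall>t \<ge> 0. R j t > 0 \<longrightarrow> j \<in> available A (unfinished n p R t)) \<and>
     (\<forall>j \<in> {1..n}. \<exists>t \<ge> 0. p j \<le> work R j t)"

definition completion_time :: "(nat \<Rightarrow> real) \<Rightarrow> (nat \<Rightarrow> real \<Rightarrow> real) \<Rightarrow> nat \<Rightarrow> real" where
  "completion_time p R j = (LEAST t. 0 \<le> t \<and> p j \<le> work R j t)"

definition total_weighted_completion_time ::
  "nat \<Rightarrow> (nat \<Rightarrow> real) \<Rightarrow> (nat \<Rightarrow> real) \<Rightarrow> (nat \<Rightarrow> real \<Rightarrow> real) \<Rightarrow> real" where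
  "total_weighted_completion_time n p w R = (\<Sum>j = 1..n. w j * completion_time p R j)"


subsection \<open>The rate computation\<close>

datatype vertex = NodeA | NodeB | NodeZ | Job nat

definition vertices :: "nat set \<Rightarrow> vertex set" where
  "vertices U = Job ` U \<union> {NodeA, NodeB, NodeZ}"

definition arcs :: "(nat \<times> nat) set \<Rightarrow> nat set \<Rightarrow> (vertex \<times> vertex) set" where
  "arcs A U =
     {(Job j, Job k) | j k. (j, k) \<in> A \<and> j \<in> U \<and> k \<in> U} \<union>
     {(NodeA, NodeB)} \<union>
     {(NodeB, Job j) | j. j \<in> available A U} \<union>
     {(Job j, NodeZ) | j. j \<in> U}"

text \<open>The last equation only concerns pairs that are not arcs.\<close>

fun capacity :: "nat \<Rightarrow> (nat \<Rightarrow> real) \<Rightarrow> real \<Rightarrow> vertex \<times> vertex \<Rightarrow> ereal" where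
  "capacity m w \<pi> (NodeA, NodeB) = ereal (real m)"
| "capacity m w \<pi> (NodeB, Job j) = 1"
| "capacity m w \<pi> (Job j, Job k) = \<infinity>"
| "capacity m w \<pi> (Job j, NodeZ) = ereal (w j / \<pi>)"
| "capacity m w \<pi> _ = 0"

definition admissible_price ::
  "nat \<Rightarrow> (nat \<Rightarrow> real) \<Rightarrow> (nat \<times> nat) set \<Rightarrow> nat set \<Rightarrow> real \<Rightarrow> bool" where
  "admissible_price m w A U \<pi> \<longleftrightarrow> \<pi> > 0 \<and>
     is_min_cut (vertices U) (arcs A U) (capacity m w \<pi>) NodeA NodeZ {NodeA}"

definition is_max_price ::
  "nat \<Rightarrow> (nat \<Rightarrow> real) \<Rightarrow> (nat \<times> nat) set \<Rightarrow> nat set \<Rightarrow> real \<Rightarrow> bool" where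
  "is_max_price m w A U \<pi> \<longleftrightarrow> admissible_price m w A U \<pi> \<and>
     (\<forall>\<pi>'. admissible_price m w A U \<pi>' \<longrightarrow> \<pi>' \<le> \<pi>)"

text \<open>The possible outcomes \<open>r\<close> of the computation when \<open>U\<close> is the set of unfinished jobs.
  This is a relation because the maximum flow need not be unique. It does not refer to
  processing times, which makes the policy non-clairvoyant.\<close>

definition computed_rates ::
  "nat \<Rightarrow> (nat \<Rightarrow> real) \<Rightarrow> (nat \<times> nat) set \<Rightarrow> nat set \<Rightarrow> (nat \<Rightarrow> real) \<Rightarrow> bool" where
  "computed_rates m w A U r \<longleftrightarrow>
     (\<forall>j. j \<notin> available A U \<longrightarrow> r j = 0) \<and>
     (if card (available A U) \<le> m then \<forall>j \<in> available A U. r j = 1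
      else \<exists>\<pi> x. is_max_price m w A U \<pi> \<and>
             is_max_flow (vertices U) (arcs A U) (capacity m w \<pi>) NodeA NodeZ x \<and>
             (\<forall>j \<in> available A U. r j = x (NodeB, Job j)))"


subsection \<open>The policy\<close>

definition completes_at :: "(nat \<Rightarrow> real) \<Rightarrow> (nat \<Rightarrow> real \<Rightarrow> real) \<Rightarrow> nat \<Rightarrow> real \<Rightarrow> bool" where
  "completes_at p R j t \<longleftrightarrow> 0 \<le> t \<and> p j \<le> work R j t \<and>
     (\<forall>s. 0 \<le> s \<and> p j \<le> work R j s \<longrightarrow> t \<le> s)"

definition completion_events ::
  "nat \<Rightarrow> (nat \<Rightarrow> real) \<Rightarrow> (nat \<Rightarrow> real \<Rightarrow> real) \<Rightarrow> real set" where
  "completion_events n p R = {t. \<exists>j \<in> {1..n}. completes_at p R j t}"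

text \<open>Recomputing also at the last completion time, when no job is unfinished, merely says
  that all rates are zero from then on.\<close>

definition follows_policy ::
  "nat \<Rightarrow> nat \<Rightarrow> (nat \<Rightarrow> real) \<Rightarrow> (nat \<Rightarrow> real) \<Rightarrow> (nat \<times> nat) set \<Rightarrow> (nat \<Rightarrow> real \<Rightarrow> real) \<Rightarrow> bool"
  where
  "follows_policy n m p w A R \<longleftrightarrow>
     (\<forall>t \<in> {0} \<union> completion_events n p R.
        \<exists>r. computed_rates m w A (unfinished n p R t) r \<and>
            (\<forall>s \<ge> t. {t<..s} \<inter> completion_events n p R = {} \<longrightarrow>
               (\<forall>j \<in> {1..n}. R j s = r j)))"

end

theory Submission
  imports Defs
begin

text \<open>
  When more than \<open>m\<close> jobs are available, the price \<open>\<pi>\<close> is maximal, so besides \<open>{A}\<close> there is a second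
  minimum cut; it corresponds to a successor-closed set \<open>T\<close> of unfinished jobs with \<open>w(T) \<le> \<pi> m\<close>,
  and the available jobs outside \<open>T\<close> run at rate \<open>1\<close>. When at most \<open>m\<close> jobs are available, let \<open>T\<close> be
  empty. Split the cost of the algorithm, which is the integral of the unfinished weight, along \<open>T\<close>.

  While a job is outside \<open>T\<close>, so are all its unfinished predecessors, hence the available ones run at
  full speed. The total time that it spends there is therefore at most the length of some chain
  ending in it, and so at most its completion time in any schedule. This part costs at most \<open>OPT\<close>.

  For the weight inside \<open>T\<close>, order the jobs by their completion times in the optimum. The flow shows
  that every successor-closed set \<open>Q\<close> satisfies \<open>\<pi> R(Q) \<le> w(Q)\<close>; applied to the sets of jobs not
  before a given job \<open>k\<close>, and summed over \<open>k\<close> with weights \<open>R k\<close>, this gives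
  \<open>\<pi> m\<^sup>2 / 2 \<le> \<Sum>k. R k * w {j. k not after j}\<close>. Integrated over time, the right-hand side is at most
  \<open>\<Sum>j. w j * p {k. k not after j} \<le> m OPT\<close>, so that this part costs at most \<open>2 OPT\<close>.
\<close>

section \<open>Maximum flows and cuts\<close>

lemma sum_inflow:
  assumes "finite E" "finite S"
  shows "(\<Sum>v\<in>S. inflow E x v) = (\<Sum>e\<in>{e\<in>E. snd e \<in> S}. x e)"
proof -
  have "{e\<in>E. snd e \<in> S} = (\<Union>v\<in>S. {e\<in>E. snd e = v})" by auto
  then show ?thesis
    unfolding inflow_def using assms by (subst sum.UNION_disjoint[symmetric]) auto
qed

lemma sum_outflow:
  assumes "finite E" "finite S"
  shows "(\<Sum>v\<in>S. outflow E x v) = (\<Sum>e\<in>{e\<in>E. fst e \<in> S}. x e)"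
proof -
  have "{e\<in>E. fst e \<in> S} = (\<Union>v\<in>S. {e\<in>E. fst e = v})" by auto
  then show ?thesis
    unfolding outflow_def using assms by (subst sum.UNION_disjoint[symmetric]) auto
qed

definition net_inflow :: "('v \<times> 'v) set \<Rightarrow> ('v \<times> 'v \<Rightarrow> real) \<Rightarrow> 'v \<Rightarrow> real" where
  "net_inflow E x v = inflow E x v - outflow E x v"

lemma net_inflow_add_scaled:
  "net_inflow E (\<lambda>e. x e + c * d e) v = net_inflow E x v + c * net_inflow E d v"
  by (simp add: net_inflow_def inflow_def outflow_def sum.distrib sum_distrib_left algebra_simps)

lemma net_inflow_single:
  assumes "finite E" "(a, b) \<in> E" "a \<noteq> b"
  shows "net_inflow E (\<lambda>e. if e = (a, b) then 1 else 0) v =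
    (if v = b then 1 else 0) - (if v = a then 1 else 0)"
  using assms by (auto simp: net_inflow_def inflow_def outflow_def sum.delta)

text \<open>Arcs with both ends in \<open>S\<close> occur once with each sign and cancel, so only
  arcs across the boundary remain.\<close>

lemma sum_net_inflow:
  assumes "finite E" "finite S"
  shows "(\<Sum>v\<in>S. net_inflow E x v) =
    (\<Sum>e\<in>{e\<in>E. fst e \<notin> S \<and> snd e \<in> S}. x e) - (\<Sum>e\<in>{e\<in>E. fst e \<in> S \<and> snd e \<notin> S}. x e)"
proof -
  have 1: "(\<Sum>e\<in>{e\<in>E. snd e \<in> S}. x e) =
     (\<Sum>e\<in>{e\<in>E. fst e \<notin> S \<and> snd e \<in> S}. x e) + (\<Sum>e\<in>{e\<in>E. fst e \<in> S \<and> snd e \<in> S}. x e)"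
    using assms(1) by (subst sum.union_disjoint[symmetric]) (auto intro!: sum.cong)
  have 2: "(\<Sum>e\<in>{e\<in>E. fst e \<in> S}. x e) =
     (\<Sum>e\<in>{e\<in>E. fst e \<in> S \<and> snd e \<notin> S}. x e) + (\<Sum>e\<in>{e\<in>E. fst e \<in> S \<and> snd e \<in> S}. x e)"
    using assms(1) by (subst sum.union_disjoint[symmetric]) (auto intro!: sum.cong)
  show ?thesis
    unfolding net_inflow_def sum_subtractf
    using sum_inflow[OF assms, of x] sum_outflow[OF assms, of x] 1 2 by simp
qed

text \<open>A unit amount can be sent from \<open>s\<close> to \<open>v\<close> along an infinitesimally feasible change of
  the flow. This replaces residual paths: such directions form a convex cone, so extending a
  path by an arc is adding an indicator function, and no step lengths are needed.\<close>

definition augmenting_direction ::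
  "'v set \<Rightarrow> ('v \<times> 'v) set \<Rightarrow> ('v \<times> 'v \<Rightarrow> ereal) \<Rightarrow> 'v \<Rightarrow> ('v \<times> 'v \<Rightarrow> real) \<Rightarrow> 'v
    \<Rightarrow> ('v \<times> 'v \<Rightarrow> real) \<Rightarrow> bool" where
  "augmenting_direction V E u s x v d \<longleftrightarrow>
     (\<forall>e\<in>E. (x e = 0 \<longrightarrow> 0 \<le> d e) \<and> (ereal (x e) = u e \<longrightarrow> d e \<le> 0)) \<and>
     (\<forall>v'\<in>V - {s}. net_inflow E d v' = (if v' = v then 1 else 0))"

text \<open>The unit that arrives at \<open>a\<close> is passed on to \<open>b\<close>. Raising an
  arc respects the lower condition, and an unsaturated arc is subject to no upper one. The factor
  \<open>1\<close> gives the term the form in which \<open>net_inflow_add_scaled\<close>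
  applies.\<close>

lemma augmenting_direction_step:
  assumes "finite E" "augmenting_direction V E u s x a d" "(a, b) \<in> E" "a \<noteq> b"
    "ereal (x (a, b)) \<noteq> u (a, b)"
  shows "augmenting_direction V E u s x b (\<lambda>e. d e + 1 * (if e = (a, b) then 1 else 0))"
  using assms unfolding augmenting_direction_def net_inflow_add_scaled
  by (auto simp: net_inflow_single intro: add_nonneg_nonneg)

text \<open>The unit at \<open>a\<close> reaches \<open>b\<close> by cancelling flow on
  \<open>(b, a)\<close>, which is subject to no lower condition because it carries flow.\<close>

lemma augmenting_direction_step_back:
  assumes "finite E" "augmenting_direction V E u s x a d" "(b, a) \<in> E" "a \<noteq> b"
    "x (b, a) \<noteq> 0"
  shows "augmenting_direction V E u s x b (\<lambda>e. d e + (-1) * (if e = (b, a) then 1 else 0))"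
  using assms unfolding augmenting_direction_def net_inflow_add_scaled
  by (force simp: net_inflow_single)

text \<open>A strict bound survives a small step by continuity, a tight one because \<open>d\<close>
  does not point outwards. Phrasing this with \<open>at_right\<close> lets finitely many arcs share
  one step length.\<close>

lemma feasible_step_length:
  assumes "0 \<le> x" "ereal x \<le> u" "x = 0 \<longrightarrow> 0 \<le> d" "ereal x = u \<longrightarrow> d \<le> (0::real)"
  shows "\<forall>\<^sub>F c in at_right 0. 0 \<le> x + c * d \<and> ereal (x + c * d) \<le> u"
proof -
  have lim: "((\<lambda>c. x + c * d) \<longlongrightarrow> x + 0 * d) (at_right 0)"
    by (intro tendsto_intros)
  have pos: "\<forall>\<^sub>F c::real in at_right 0. 0 < c" by (simp add: eventually_at_right_less)
  have "\<forall>\<^sub>F c in at_right 0. 0 \<le> x + c * d"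
  proof (cases "x = 0")
    case True
    then show ?thesis using pos assms(3) by (auto elim: eventually_mono)
  next
    case False
    then have "0 < x + 0 * d" using assms(1) by simp
    from order_tendstoD(1)[OF lim this] show ?thesis by (auto elim: eventually_mono)
  qed
  moreover have "\<forall>\<^sub>F c in at_right 0. ereal (x + c * d) \<le> u"
  proof (cases "ereal x = u")
    case True
    have "ereal (x + c * d) \<le> u" if "0 < c" for c
    proof -
      have "c * d \<le> 0" using True assms(4) that by (simp add: mult_nonneg_nonpos)
      then show ?thesis using True by (metis add.right_neutral add_left_mono ereal_less_eq(3))
    qed
    then show ?thesis using pos by (auto elim: eventually_mono)
  next
    case False
    then have "ereal x < u" using assms(2) by simp
    then obtain y where y: "x < y" "ereal y < u" using ereal_dense2[of "ereal x" u] by auto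
    from order_tendstoD(2)[OF lim, of y] y(1) have "\<forall>\<^sub>F c in at_right 0. x + c * d < y" by simp
    then show ?thesis
      by (rule eventually_mono) (use y(2) in \<open>meson ereal_less_eq(3) less_imp_le order_trans\<close>)
  qed
  ultimately show ?thesis by eventually_elim simp
qed

text \<open>A small multiple of \<open>d\<close> could be added to \<open>x\<close>. The net inflows
  of \<open>d\<close> over all of \<open>V\<close> cancel, so the unit gained at \<open>t\<close> is
  lost at \<open>s\<close>, and the flow value would grow.\<close>

lemma max_flow_no_augmenting_direction:
  assumes fin: "finite V" "finite E" "E \<subseteq> V \<times> V" and st: "s \<in> V" "t \<in> V" "s \<noteq> t"
    and x: "is_max_flow V E u s t x"
  shows "\<not> augmenting_direction V E u s x t d"
proof
  assume d: "augmenting_direction V E u s x t d"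
  have flow: "is_flow V E u s t x" using x by (simp add: is_max_flow_def)
  have "\<forall>\<^sub>F c in at_right 0. \<forall>e\<in>E. 0 \<le> x e + c * d e \<and> ereal (x e + c * d e) \<le> u e"
    using flow d fin(2) unfolding is_flow_def augmenting_direction_def
    by (intro eventually_ball_finite ballI feasible_step_length) auto
  moreover have "\<forall>\<^sub>F c::real in at_right 0. 0 < c" by (simp add: eventually_at_right_less)
  ultimately have "\<forall>\<^sub>F c in at_right 0. 0 < c \<and> (\<forall>e\<in>E. 0 \<le> x e + c * d e \<and> ereal (x e + c * d e) \<le> u e)"
    by eventually_elim simp
  then obtain c where c: "0 < c" "\<forall>e\<in>E. 0 \<le> x e + c * d e \<and> ereal (x e + c * d e) \<le> u e"
    using eventually_happens'[OF trivial_limit_at_right_real] by blast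
  let ?y = "\<lambda>e. x e + c * d e"
  have "net_inflow E ?y v = 0" if "v \<in> V - {s, t}" for v
    using that flow d unfolding net_inflow_add_scaled
    by (simp add: is_flow_def augmenting_direction_def net_inflow_def)
  then have "is_flow V E u s t ?y"
    using c(2) by (simp add: is_flow_def net_inflow_def)
  then have "flow_value E s ?y \<le> flow_value E s x" using x by (simp add: is_max_flow_def)
  then have "c * net_inflow E d s \<ge> 0"
    using net_inflow_add_scaled[of E x c d s] by (simp add: flow_value_def net_inflow_def)
  then have "net_inflow E d s \<ge> 0" using c(1) by (simp add: zero_le_mult_iff)
  moreover have "(\<Sum>v\<in>V. net_inflow E d v) = 0"
  proof -
    have "{e \<in> E. fst e \<notin> V \<and> snd e \<in> V} = {}" "{e \<in> E. fst e \<in> V \<and> snd e \<notin> V} = {}"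
      using fin(3) by auto
    then show ?thesis
      unfolding sum_net_inflow[OF fin(2,1)] by (simp only: sum.empty)
  qed
  moreover have "(\<Sum>v\<in>V. net_inflow E d v) = net_inflow E d s + (\<Sum>v\<in>V - {s}. net_inflow E d v)"
    using fin(1) st(1) by (rule sum.remove)
  moreover have "(\<Sum>v\<in>V - {s}. net_inflow E d v) = (\<Sum>v\<in>V - {s}. if v = t then 1 else 0)"
    using d by (intro sum.cong) (auto simp: augmenting_direction_def)
  moreover have "\<dots> = 1" using fin(1) st by (simp add: sum.delta)
  ultimately show False by simp
qed

text \<open>The cut consists of the vertices reached by augmenting directions. Its outgoing arcs are
  saturated and its incoming ones empty, since otherwise a direction could be extended across; hence
  the net flow over the boundary equals the capacity. Infinite capacities do no harm, as an outgoing
  arc is saturated by a real number.\<close>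

lemma max_flow_eq_cut:
  assumes fin: "finite V" "finite E" "E \<subseteq> V \<times> V" and st: "s \<in> V" "t \<in> V" "s \<noteq> t"
    and x: "is_max_flow V E u s t x"
  obtains S where "is_cut V s t S" "cut_capacity E u S = ereal (flow_value E s x)"
proof
  define S where "S = {v \<in> V. \<exists>d. augmenting_direction V E u s x v d}"
  have flow: "is_flow V E u s t x" using x by (simp add: is_max_flow_def)
  \<comment> \<open>The zero direction reaches \<open>s\<close>, where no net inflow is
    prescribed.\<close>
  have sS: "s \<in> S"
    using st(1) unfolding S_def augmenting_direction_def
    by (auto intro!: exI[of _ "\<lambda>_. 0"] simp: net_inflow_def inflow_def outflow_def)
  have tS: "t \<notin> S" using max_flow_no_augmenting_direction[OF assms] by (simp add: S_def)
  show "is_cut V s t S" using sS tS by (auto simp: is_cut_def S_def)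
  have sat: "ereal (x e) = u e" if crossing: "e \<in> E" "fst e \<in> S" "snd e \<notin> S" for e
  proof (rule ccontr)
    assume neq: "ereal (x e) \<noteq> u e"
    obtain a b where e: "e = (a, b)" by fastforce
    obtain d where "augmenting_direction V E u s x a d" using crossing e by (auto simp: S_def)
    from augmenting_direction_step[OF fin(2) this, of b] crossing e neq fin(3) show False
      by (auto simp: S_def)
  qed
  have zero: "x e = 0" if crossing: "e \<in> E" "fst e \<notin> S" "snd e \<in> S" for e
  proof (rule ccontr)
    assume neq: "x e \<noteq> 0"
    obtain a b where e: "e = (b, a)" by fastforce
    obtain d where "augmenting_direction V E u s x a d" using crossing e by (auto simp: S_def)
    from augmenting_direction_step_back[OF fin(2) this, of b] crossing e neq fin(3) show False
      by (auto simp: S_def)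
  qed
  have SV: "S \<subseteq> V" by (auto simp: S_def)
  have "(\<Sum>v\<in>S. net_inflow E x v) = net_inflow E x s + (\<Sum>v\<in>S - {s}. net_inflow E x v)"
    using fin(1) SV sS finite_subset by (intro sum.remove) auto
  moreover have "(\<Sum>v\<in>S - {s}. net_inflow E x v) = 0"
    using flow SV tS by (intro sum.neutral) (auto simp: is_flow_def net_inflow_def)
  ultimately have "net_inflow E x s = - (\<Sum>e\<in>{e\<in>E. fst e \<in> S \<and> snd e \<notin> S}. x e)"
    using sum_net_inflow[OF fin(2) finite_subset[OF SV fin(1)], of x] zero by simp
  then have "flow_value E s x = (\<Sum>e\<in>{e\<in>E. fst e \<in> S \<and> snd e \<notin> S}. x e)"
    by (simp add: flow_value_def net_inflow_def)
  moreover have "cut_capacity E u S = (\<Sum>e\<in>{e\<in>E. fst e \<in> S \<and> snd e \<notin> S}. ereal (x e))"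
    unfolding cut_capacity_def using sat by (intro sum.cong) auto
  ultimately show "cut_capacity E u S = ereal (flow_value E s x)" by simp
qed

section \<open>The computed rates\<close>

text \<open>These are the job sides of those cuts containing \<open>NodeB\<close> that no infinite
  precedence arc leaves.\<close>

definition successor_closed :: "(nat \<times> nat) set \<Rightarrow> nat set \<Rightarrow> nat set \<Rightarrow> bool" where
  "successor_closed A U Q \<longleftrightarrow> Q \<subseteq> U \<and> (\<forall>j k. (j, k) \<in> A \<and> j \<in> Q \<and> k \<in> U \<longrightarrow> k \<in> Q)"

lemma available_subset: "available A U \<subseteq> U"
  by (auto simp: available_def)

lemma finite_vertices: "finite U \<Longrightarrow> finite (vertices U)"
  by (simp add: vertices_def)

lemma vertices_simps:
  "Job j \<in> vertices U \<longleftrightarrow> j \<in> U" "NodeA \<in> vertices U" "NodeB \<in> vertices U" "NodeZ \<in> vertices U"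
  by (auto simp: vertices_def)

lemma arcs_subset_vertices: "arcs A U \<subseteq> vertices U \<times> vertices U"
  by (auto simp: arcs_def available_def vertices_simps)

lemma finite_arcs: "finite U \<Longrightarrow> finite (arcs A U)"
  by (rule finite_subset[OF arcs_subset_vertices]) (simp add: finite_vertices)

lemma arcs_at_source:
  "{e \<in> arcs A U. fst e = NodeA} = {(NodeA, NodeB)}" "{e \<in> arcs A U. snd e = NodeA} = {}"
  "{e \<in> arcs A U. fst e = NodeB} = (\<lambda>j. (NodeB, Job j)) ` available A U"
  "{e \<in> arcs A U. snd e = NodeB} = {(NodeA, NodeB)}"
  by (auto simp: arcs_def)

lemma flow_value_eq_sum_rates:
  assumes "is_flow (vertices U) (arcs A U) u NodeA NodeZ x"
  shows "flow_value (arcs A U) NodeA x = (\<Sum>j\<in>available A U. x (NodeB, Job j))"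
proof -
  have "inflow (arcs A U) x NodeB = outflow (arcs A U) x NodeB"
    using assms by (auto simp: is_flow_def vertices_def)
  moreover have "outflow (arcs A U) x NodeB = (\<Sum>j\<in>available A U. x (NodeB, Job j))"
    unfolding outflow_def arcs_at_source by (subst sum.reindex) (auto simp: inj_on_def)
  ultimately show ?thesis
    unfolding flow_value_def outflow_def inflow_def arcs_at_source by simp
qed

text \<open>What enters \<open>Q\<close> from \<open>NodeB\<close> must leave \<open>Q\<close>
  again. Closedness leaves only the arcs to \<open>NodeZ\<close> for that, and their capacities sum
  to the right-hand side.\<close>

lemma sum_rates_successor_closed_le:
  assumes U: "finite U" and x: "is_flow (vertices U) (arcs A U) (capacity m w \<pi>) NodeA NodeZ x"
    and Q: "successor_closed A U Q"
  shows "(\<Sum>j\<in>available A U \<inter> Q. x (NodeB, Job j)) \<le> sum w Q / \<pi>"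
proof -
  let ?S = "Job ` Q"
  let ?in = "{e \<in> arcs A U. fst e \<notin> ?S \<and> snd e \<in> ?S}"
  have SV: "?S \<subseteq> vertices U" using Q by (auto simp: successor_closed_def vertices_def)
  have "(\<Sum>v\<in>?S. net_inflow (arcs A U) x v) = 0"
    using x SV by (intro sum.neutral) (auto simp: is_flow_def net_inflow_def)
  then have eq: "sum x ?in = sum x {e \<in> arcs A U. fst e \<in> ?S \<and> snd e \<notin> ?S}"
    using sum_net_inflow[OF finite_arcs[OF U] finite_subset[OF SV finite_vertices[OF U]], of A x] by simp
  have "(\<Sum>j\<in>available A U \<inter> Q. x (NodeB, Job j)) = sum x ((\<lambda>j. (NodeB, Job j)) ` (available A U \<inter> Q))"
    by (subst sum.reindex) (auto simp: inj_on_def)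
  also have "\<dots> \<le> sum x ?in"
    using x by (intro sum_mono2) (auto simp: finite_arcs[OF U] is_flow_def, auto simp: arcs_def)
  also have "\<dots> = sum x {e \<in> arcs A U. fst e \<in> ?S \<and> snd e \<notin> ?S}" by (rule eq)
  also have "{e \<in> arcs A U. fst e \<in> ?S \<and> snd e \<notin> ?S} = (\<lambda>j. (Job j, NodeZ)) ` Q"
    using Q by (auto simp: arcs_def successor_closed_def)
  also have "sum x \<dots> = (\<Sum>j\<in>Q. x (Job j, NodeZ))"
    by (subst sum.reindex) (auto simp: inj_on_def)
  also have "\<dots> \<le> (\<Sum>j\<in>Q. w j / \<pi>)"
  proof (rule sum_mono)
    fix j assume "j \<in> Q"
    then have "(Job j, NodeZ) \<in> arcs A U" using Q by (auto simp: arcs_def successor_closed_def)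
    then have "ereal (x (Job j, NodeZ)) \<le> capacity m w \<pi> (Job j, NodeZ)"
      using x by (auto simp: is_flow_def)
    then show "x (Job j, NodeZ) \<le> w j / \<pi>" by simp
  qed
  finally show ?thesis by (simp add: sum_divide_distrib)
qed

section \<open>Cuts of the digraph and admissible prices\<close>

lemma cut_capacity_source: "cut_capacity (arcs A U) (capacity m w \<pi>) {NodeA} = ereal (real m)"
proof -
  have "{e \<in> arcs A U. fst e \<in> {NodeA} \<and> snd e \<notin> {NodeA}} = {(NodeA, NodeB)}"
    by (auto simp: arcs_def)
  then show ?thesis unfolding cut_capacity_def by (simp only: sum.insert sum.empty) simp
qed

lemma is_cut_closed: "successor_closed A U T \<Longrightarrow>
  is_cut (vertices U) NodeA NodeZ ({NodeA, NodeB} \<union> Job ` T)"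
  by (auto simp: is_cut_def vertices_def successor_closed_def)

text \<open>By closedness no precedence arc leaves the set. What crosses are the unit arcs from
  \<open>NodeB\<close> to available jobs outside \<open>T\<close> and the arcs from \<open>T\<close>
  to \<open>NodeZ\<close>.\<close>

lemma cut_capacity_closed:
  assumes "finite U" "successor_closed A U T"
  shows "cut_capacity (arcs A U) (capacity m w \<pi>) ({NodeA, NodeB} \<union> Job ` T) =
    ereal (real (card (available A U - T)) + sum w T / \<pi>)"
proof -
  let ?S = "{NodeA, NodeB} \<union> Job ` T"
  have fin: "finite T" "finite (available A U - T)"
    using assms available_subset[of A U] finite_subset by (auto simp: successor_closed_def)
  have "{e \<in> arcs A U. fst e \<in> ?S \<and> snd e \<notin> ?S} =
      (\<lambda>j. (NodeB, Job j)) ` (available A U - T) \<union> (\<lambda>j. (Job j, NodeZ)) ` T"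
    using assms(2) by (auto simp: arcs_def successor_closed_def)
  then have "cut_capacity (arcs A U) (capacity m w \<pi>) ?S =
      sum (capacity m w \<pi>) ((\<lambda>j. (NodeB, Job j)) ` (available A U - T)) +
      sum (capacity m w \<pi>) ((\<lambda>j. (Job j, NodeZ)) ` T)"
    unfolding cut_capacity_def by (simp only:) (rule sum.union_disjoint, use fin in auto)
  also have "sum (capacity m w \<pi>) ((\<lambda>j. (NodeB, Job j)) ` (available A U - T)) =
      (\<Sum>j\<in>available A U - T. ereal 1)"
    by (subst sum.reindex) (auto simp: inj_on_def one_ereal_def)
  also have "\<dots> = ereal (real (card (available A U - T)))"
    by (subst sum_ereal) simp
  also have "sum (capacity m w \<pi>) ((\<lambda>j. (Job j, NodeZ)) ` T) = (\<Sum>j\<in>T. ereal (w j / \<pi>))"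
    by (subst sum.reindex) (auto simp: inj_on_def)
  also have "\<dots> = ereal (sum w T / \<pi>)"
    by (simp add: sum_divide_distrib)
  finally show ?thesis by simp
qed

lemma capacity_nonneg:
  assumes "\<pi> > 0" "\<And>j. j \<in> U \<Longrightarrow> 0 \<le> w j" "e \<in> arcs A U"
  shows "0 \<le> capacity m w \<pi> e"
  using assms by (auto simp: arcs_def)

lemma cut_capacity_ge_arc:
  assumes "finite U" "\<pi> > 0" "\<And>j. j \<in> U \<Longrightarrow> 0 \<le> w j" "e \<in> arcs A U" "fst e \<in> S" "snd e \<notin> S"
  shows "capacity m w \<pi> e \<le> cut_capacity (arcs A U) (capacity m w \<pi>) S"
proof -
  have "sum (capacity m w \<pi>) {e} \<le> cut_capacity (arcs A U) (capacity m w \<pi>) S"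
    unfolding cut_capacity_def
    using assms finite_arcs[OF assms(1), of A] capacity_nonneg[of \<pi> U w] by (intro sum_mono2) auto
  then show ?thesis by simp
qed

text \<open>Only cuts given by closed sets can undercut \<open>{NodeA}\<close>: a cut without
  \<open>NodeB\<close> already pays \<open>m\<close> for the arc to it, and one with
  \<open>NodeB\<close> whose jobs are not closed is crossed by an infinite arc.\<close>

lemma admissible_price_iff:
  assumes U: "finite U" and w: "\<And>j. j \<in> U \<Longrightarrow> 0 \<le> w j"
  shows "admissible_price m w A U \<pi> \<longleftrightarrow> \<pi> > 0 \<and>
    (\<forall>T. successor_closed A U T \<longrightarrow> real m \<le> real (card (available A U - T)) + sum w T / \<pi>)"
    (is "?L \<longleftrightarrow> ?R")
proof
  assume ?L
  show ?R
  proof (intro conjI allI impI)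
    show "\<pi> > 0" using \<open>?L\<close> by (simp add: admissible_price_def)
    fix T assume T: "successor_closed A U T"
    show "real m \<le> real (card (available A U - T)) + sum w T / \<pi>"
      using \<open>?L\<close> is_cut_closed[OF T] cut_capacity_closed[OF U T, of m w \<pi>] cut_capacity_source[of A U m w \<pi>]
      unfolding admissible_price_def is_min_cut_def by (metis ereal_less_eq(3))
  qed
next
  assume R: ?R
  have "ereal (real m) \<le> cut_capacity (arcs A U) (capacity m w \<pi>) S"
    if S: "is_cut (vertices U) NodeA NodeZ S" for S
  proof (cases "NodeB \<in> S")
    case False
    then show ?thesis
      using cut_capacity_ge_arc[OF U, of \<pi> w "(NodeA, NodeB)" A S m] R w S
      by (auto simp: arcs_def is_cut_def)
  next
    case B: True
    define T where "T = {j. Job j \<in> S}"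
    have S_eq: "S = {NodeA, NodeB} \<union> Job ` T"
    proof
      show "S \<subseteq> {NodeA, NodeB} \<union> Job ` T"
      proof
        fix v assume "v \<in> S"
        then show "v \<in> {NodeA, NodeB} \<union> Job ` T"
          using S by (cases v) (auto simp: T_def is_cut_def)
      qed
      show "{NodeA, NodeB} \<union> Job ` T \<subseteq> S" using S B by (auto simp: T_def is_cut_def)
    qed
    show ?thesis
    proof (cases "successor_closed A U T")
      case True
      then show ?thesis using R cut_capacity_closed[OF U True, of m w \<pi>] S_eq by simp
    next
      case False
      have "T \<subseteq> U" using S by (auto simp: T_def is_cut_def vertices_def)
      then obtain j k where "(j, k) \<in> A" "j \<in> T" "k \<in> U" "k \<notin> T"
        using False by (auto simp: successor_closed_def)
      then show ?thesis
        using cut_capacity_ge_arc[OF U, of \<pi> w "(Job j, Job k)" A S m] R w S \<open>T \<subseteq> U\<close>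
        by (auto simp: arcs_def T_def)
    qed
  qed
  then show ?L
    using R unfolding admissible_price_def is_min_cut_def cut_capacity_source
    by (auto simp: is_cut_def vertices_def)
qed

text \<open>A price that admits no tight closed set could still be raised.\<close>

lemma max_price_tight_set:
  assumes U: "finite U" and w: "\<And>j. j \<in> U \<Longrightarrow> 0 \<le> w j" and \<pi>: "is_max_price m w A U \<pi>"
  obtains T where "successor_closed A U T"
    "real m = real (card (available A U - T)) + sum w T / \<pi>"
proof -
  note adm = admissible_price_iff[where U = U and w = w, OF U w]
  let ?f = "\<lambda>T \<pi>. real (card (available A U - T)) + sum w T / \<pi>"
  have pos: "\<pi> > 0" and le: "\<And>T. successor_closed A U T \<Longrightarrow> real m \<le> ?f T \<pi>"
    using \<pi> adm by (auto simp: is_max_price_def)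
  have "\<exists>T. successor_closed A U T \<and> \<not> real m < ?f T \<pi>"
  proof (rule ccontr)
    assume neg: "\<nexists>T. successor_closed A U T \<and> \<not> real m < ?f T \<pi>"
    have "finite {T. successor_closed A U T}"
      by (rule finite_subset[of _ "Pow U"]) (auto simp: successor_closed_def U)
    \<comment> \<open>Each strict inequality persists for slightly larger prices, and as there are
      finitely many closed sets, one larger price serves all of them.\<close>
    moreover have "\<forall>\<^sub>F \<pi>' in at_right \<pi>. real m < ?f T \<pi>'" if "successor_closed A U T" for T
    proof (rule order_tendstoD(1))
      show "(?f T \<longlongrightarrow> ?f T \<pi>) (at_right \<pi>)"
        using pos by (intro tendsto_intros) auto
      show "real m < ?f T \<pi>" using neg that by auto
    qed
    ultimately have "\<forall>\<^sub>F \<pi>' in at_right \<pi>. \<forall>T\<in>{T. successor_closed A U T}. real m < ?f T \<pi>'"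
      by (intro eventually_ball_finite) auto
    moreover have "\<forall>\<^sub>F \<pi>' in at_right \<pi>. \<pi> < \<pi>'" by (simp add: eventually_at_right_less)
    ultimately have "\<forall>\<^sub>F \<pi>' in at_right \<pi>. \<pi> < \<pi>' \<and> (\<forall>T\<in>{T. successor_closed A U T}. real m < ?f T \<pi>')"
      by eventually_elim simp
    then obtain \<pi>' where "\<pi> < \<pi>'" "\<forall>T\<in>{T. successor_closed A U T}. real m < ?f T \<pi>'"
      using eventually_happens'[OF trivial_limit_at_right_real] by blast
    then have "admissible_price m w A U \<pi>'" "\<pi> < \<pi>'"
      using pos by (auto simp: adm less_imp_le)
    then show False using \<pi> by (auto simp: is_max_price_def)
  qed
  then show ?thesis using that le by (metis order_le_imp_less_or_eq)
qed

text \<open>The flow value is the capacity of some cut, hence at least that of the minimum cut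
  \<open>{NodeA}\<close>, which is \<open>m\<close>; the arc out of \<open>NodeA\<close> gives the
  other inequality.\<close>

lemma max_flow_saturates_source:
  assumes U: "finite U" and "admissible_price m w A U \<pi>"
    and x: "is_max_flow (vertices U) (arcs A U) (capacity m w \<pi>) NodeA NodeZ x"
  shows "(\<Sum>j\<in>available A U. x (NodeB, Job j)) = real m"
proof -
  have flow: "is_flow (vertices U) (arcs A U) (capacity m w \<pi>) NodeA NodeZ x"
    using x by (simp add: is_max_flow_def)
  obtain S where "is_cut (vertices U) NodeA NodeZ S"
    "cut_capacity (arcs A U) (capacity m w \<pi>) S = ereal (flow_value (arcs A U) NodeA x)"
    by (rule max_flow_eq_cut[OF finite_vertices[OF U] finite_arcs[OF U] arcs_subset_vertices _ _ _ x])
      (auto simp: vertices_def)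
  then have "real m \<le> flow_value (arcs A U) NodeA x"
    using assms(2) cut_capacity_source[of A U m w \<pi>]
    unfolding admissible_price_def is_min_cut_def by (metis ereal_less_eq(3))
  moreover have "flow_value (arcs A U) NodeA x = x (NodeA, NodeB)"
    unfolding flow_value_def outflow_def inflow_def arcs_at_source by simp
  moreover have "(NodeA, NodeB) \<in> arcs A U" by (simp add: arcs_def)
  then have "ereal (x (NodeA, NodeB)) \<le> capacity m w \<pi> (NodeA, NodeB)"
    using flow unfolding is_flow_def by blast
  ultimately show ?thesis using flow_value_eq_sum_rates[OF flow] by simp
qed

text \<open>The third claim says that no capacity idles while available jobs could use it. It gives
  both the machine bound and the progress of the policy.\<close>

lemma computed_rates_bounds:
  assumes U: "finite U" and r: "computed_rates m w A U r"
  shows "0 \<le> r j" "r j \<le> 1" "(\<Sum>j\<in>available A U. r j) = real (min m (card (available A U)))"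
proof -
  have "(0 \<le> r j \<and> r j \<le> 1) \<and> (\<Sum>j\<in>available A U. r j) = real (min m (card (available A U)))"
  proof (cases "card (available A U) \<le> m")
    case True
    then show ?thesis
      using r unfolding computed_rates_def by (cases "j \<in> available A U") auto
  next
    case False
    then obtain \<pi> x where \<pi>: "is_max_price m w A U \<pi>"
      and x: "is_max_flow (vertices U) (arcs A U) (capacity m w \<pi>) NodeA NodeZ x"
      and rx: "\<forall>j\<in>available A U. r j = x (NodeB, Job j)"
      and r0: "\<forall>j. j \<notin> available A U \<longrightarrow> r j = 0"
      using r by (auto simp: computed_rates_def)
    have "0 \<le> r j \<and> r j \<le> 1"
    proof (cases "j \<in> available A U")
      case True
      then have "(NodeB, Job j) \<in> arcs A U" by (auto simp: arcs_def)
      then have "0 \<le> x (NodeB, Job j) \<and> ereal (x (NodeB, Job j)) \<le> capacity m w \<pi> (NodeB, Job j)"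
        using x unfolding is_max_flow_def is_flow_def by blast
      then show ?thesis using True rx by simp
    qed (use r0 in auto)
    moreover have "(\<Sum>j\<in>available A U. r j) = real m"
      using max_flow_saturates_source[OF U _ x] \<pi> rx by (simp add: is_max_price_def)
    ultimately show ?thesis using False by simp
  qed
  then show "0 \<le> r j" "r j \<le> 1" "(\<Sum>j\<in>available A U. r j) = real (min m (card (available A U)))"
    by auto
qed

text \<open>Any two elements are ordered by \<open>c\<close> in at least one direction, so each
  product in the expanded square is covered by one of the two orientations. This is the source of
  the factor \<open>2\<close>.\<close>

lemma sum_square_le_ordered_pairs:
  fixes r c :: "'a \<Rightarrow> real"
  assumes "finite F" "\<And>k. k \<in> F \<Longrightarrow> 0 \<le> r k"
  shows "(sum r F)\<^sup>2 \<le> 2 * (\<Sum>k\<in>F. r k * (\<Sum>l\<in>{l\<in>F. c k \<le> c l}. r l))"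
proof -
  let ?g = "\<lambda>k l. if c k \<le> c l then r k * r l else 0"
  have eq: "(\<Sum>k\<in>F. r k * (\<Sum>l\<in>{l\<in>F. c k \<le> c l}. r l)) = (\<Sum>k\<in>F. \<Sum>l\<in>F. ?g k l)"
    unfolding sum_distrib_left sum.inter_filter[OF assms(1)]
    by (intro sum.cong refl) simp
  have "(sum r F)\<^sup>2 = (\<Sum>k\<in>F. \<Sum>l\<in>F. r k * r l)"
    by (simp add: power2_eq_square sum_product)
  also have "\<dots> \<le> (\<Sum>k\<in>F. \<Sum>l\<in>F. ?g k l + ?g l k)"
    using assms(2) by (intro sum_mono) (auto simp: mult.commute)
  also have "\<dots> = (\<Sum>k\<in>F. \<Sum>l\<in>F. ?g k l) + (\<Sum>k\<in>F. \<Sum>l\<in>F. ?g l k)"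
    by (simp add: sum.distrib)
  also have "(\<Sum>k\<in>F. \<Sum>l\<in>F. ?g l k) = (\<Sum>k\<in>F. \<Sum>l\<in>F. ?g k l)"
    by (rule sum.swap)
  finally show ?thesis using eq by simp
qed

text \<open>Here \<open>T\<close> is a tight closed set. Jobs outside \<open>T\<close> have all their available predecessors
  running at full speed; the weight of \<open>T\<close> is at most \<open>\<pi> m\<close>, and each set
  \<open>{j \<in> U. c k \<le> c j}\<close> is closed, so that its weight pays for the rates inside it.\<close>

lemma computed_rates_tight_set:
  assumes U: "finite U" and w: "\<And>j. j \<in> U \<Longrightarrow> 0 \<le> w j" and r: "computed_rates m w A U r"
  obtains T where "successor_closed A U T" "\<And>j. j \<in> available A U - T \<Longrightarrow> r j = 1"
    "\<And>c :: nat \<Rightarrow> real. (\<And>j k. (j, k) \<in> A \<Longrightarrow> j \<in> U \<Longrightarrow> k \<in> U \<Longrightarrow> c j \<le> c k) \<Longrightarrow>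
      real m * sum w T \<le> 2 * (\<Sum>k\<in>available A U. r k * sum w {j\<in>U. c k \<le> c j})"
proof (cases "card (available A U) \<le> m")
  case True
  show ?thesis
  proof
    show "successor_closed A U {}" by (simp add: successor_closed_def)
    show "r j = 1" if "j \<in> available A U - {}" for j
      using that True r by (simp add: computed_rates_def)
    show "real m * sum w {} \<le> 2 * (\<Sum>k\<in>available A U. r k * sum w {j\<in>U. c k \<le> c j})" for c :: "nat \<Rightarrow> real"
      using computed_rates_bounds(1)[OF U r] w
      by (auto intro!: sum_nonneg mult_nonneg_nonneg)
  qed
next
  case False
  let ?F = "available A U"
  have finF: "finite ?F" using U available_subset finite_subset by blast
  obtain \<pi> x where \<pi>: "is_max_price m w A U \<pi>"
    and x: "is_max_flow (vertices U) (arcs A U) (capacity m w \<pi>) NodeA NodeZ x"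
    and rx: "\<forall>j\<in>?F. r j = x (NodeB, Job j)"
    using r False by (auto simp: computed_rates_def)
  have pos: "\<pi> > 0" using \<pi> by (simp add: is_max_price_def admissible_price_def)
  have sum_r: "sum r ?F = real m"
    using computed_rates_bounds(3)[OF U r] False by simp
  have closed: "sum r (?F \<inter> Q) \<le> sum w Q / \<pi>" if "successor_closed A U Q" for Q
    using sum_rates_successor_closed_le[OF U _ that, of m w \<pi> x] x rx by (simp add: is_max_flow_def)
  obtain T where T: "successor_closed A U T" "real m = real (card (?F - T)) + sum w T / \<pi>"
    using max_price_tight_set[OF U w \<pi>] by blast
  show ?thesis
  proof
    show "successor_closed A U T" by (rule T)
    \<comment> \<open>The rates inside \<open>T\<close> sum to at most
      \<open>sum w T / \<pi>\<close>, so by tightness those outside sum to at least the number of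
      jobs there. No rate exceeds one, hence all of them equal one.\<close>
    have "sum r ?F = sum r (?F \<inter> T) + sum r (?F - T)" using finF by (rule sum.Int_Diff)
    then have "(\<Sum>j\<in>?F - T. 1 - r j) \<le> 0"
      using closed[OF T(1)] T(2) sum_r by (simp add: sum_subtractf)
    then have "\<forall>j\<in>?F - T. 1 - r j = 0"
      using sum_nonneg_eq_0_iff[of "?F - T" "\<lambda>j. 1 - r j"] finF computed_rates_bounds(2)[OF U r]
        sum_nonneg[of "?F - T" "\<lambda>j. 1 - r j"] by fastforce
    then show "r j = 1" if "j \<in> ?F - T" for j using that by simp
    fix c :: "nat \<Rightarrow> real"
    assume c: "\<And>j k. (j, k) \<in> A \<Longrightarrow> j \<in> U \<Longrightarrow> k \<in> U \<Longrightarrow> c j \<le> c k"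
    \<comment> \<open>As \<open>c\<close> does not decrease along precedences, the jobs not before
      \<open>k\<close> form a closed set.\<close>
    have Q: "\<pi> * sum r {l\<in>?F. c k \<le> c l} \<le> sum w {j\<in>U. c k \<le> c j}" for k
    proof -
      have "successor_closed A U {j\<in>U. c k \<le> c j}"
        unfolding successor_closed_def using c order_trans by blast
      moreover have "?F \<inter> {j\<in>U. c k \<le> c j} = {l\<in>?F. c k \<le> c l}"
        using available_subset[of A U] by auto
      ultimately show ?thesis using closed[of "{j\<in>U. c k \<le> c j}"] pos by (simp add: field_simps)
    qed
    \<comment> \<open>Dropping the cardinality from the tightness equation leaves
      \<open>sum w T \<le> \<pi> * m\<close>.\<close>
    have "real m * sum w T \<le> real m * (\<pi> * real m)"
      using T(2) pos by (intro mult_left_mono) (auto simp: field_simps)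
    also have "\<dots> = \<pi> * (sum r ?F)\<^sup>2" by (simp add: sum_r power2_eq_square)
    also have "\<dots> \<le> \<pi> * (2 * (\<Sum>k\<in>?F. r k * sum r {l\<in>?F. c k \<le> c l}))"
      using sum_square_le_ordered_pairs[OF finF, of r c] computed_rates_bounds(1)[OF U r] pos
      by (intro mult_left_mono) auto
    also have "\<dots> = 2 * (\<Sum>k\<in>?F. r k * (\<pi> * sum r {l\<in>?F. c k \<le> c l}))"
      by (simp add: sum_distrib_left algebra_simps)
    also have "\<dots> \<le> 2 * (\<Sum>k\<in>?F. r k * sum w {j\<in>U. c k \<le> c j})"
      using Q computed_rates_bounds(1)[OF U r] by (intro mult_left_mono sum_mono) auto
    finally show "real m * sum w T \<le> 2 * (\<Sum>k\<in>?F. r k * sum w {j\<in>U. c k \<le> c j})" .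
  qed
qed

section \<open>Work and completion times\<close>

text \<open>The conditions of \<open>schedule\<close> on a single rate function, isolated because
  they are applied to a run before it is known to be a schedule.\<close>

definition unit_rate :: "(nat \<Rightarrow> real \<Rightarrow> real) \<Rightarrow> nat \<Rightarrow> bool" where
  "unit_rate R j \<longleftrightarrow> (\<forall>t\<ge>0. R j integrable_on {0..t} \<and> 0 \<le> R j t \<and> R j t \<le> 1)"

lemma unit_rate_integrable:
  assumes "unit_rate R j" "0 \<le> s"
  shows "R j integrable_on {s..t}"
proof -
  have "R j integrable_on {0..max 0 t}" using assms(1) by (simp add: unit_rate_def)
  then show ?thesis by (rule integrable_on_subinterval) (use assms(2) in auto)
qed

lemma work_split:
  assumes "unit_rate R j" "0 \<le> s" "s \<le> t"
  shows "work R j t = work R j s + integral {s..t} (R j)"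
  unfolding work_def
  using Henstock_Kurzweil_Integration.integral_combine[OF assms(2,3) unit_rate_integrable[OF assms(1) order_refl]]
  by simp

lemma work_increment:
  assumes "unit_rate R j" "0 \<le> s" "s \<le> t"
  shows "work R j s \<le> work R j t" "work R j t \<le> work R j s + (t - s)"
proof -
  have int: "R j integrable_on {s..t}" using unit_rate_integrable assms by blast
  have "0 \<le> integral {s..t} (R j)"
    using int assms by (intro integral_nonneg) (auto simp: unit_rate_def)
  moreover have "integral {s..t} (R j) \<le> integral {s..t} (\<lambda>_. 1)"
    using int assms by (intro integral_le) (auto simp: unit_rate_def)
  ultimately show "work R j s \<le> work R j t" "work R j t \<le> work R j s + (t - s)"
    using work_split[OF assms] assms(3) by auto
qed

lemma work_0 [simp]: "work R j 0 = 0"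
  by (simp add: work_def)

text \<open>Work is continuous in time, so the times up to \<open>t\<close> at which enough has been
  done form a compact set and have a minimum. This makes the \<open>LEAST\<close> in
  \<open>completion_time\<close> meaningful.\<close>

lemma completes_at_exists:
  assumes "unit_rate R j" "0 \<le> t" "p j \<le> work R j t"
  obtains C where "C \<le> t" "completes_at p R j C"
proof -
  let ?X = "{s \<in> {0..t}. p j \<le> work R j s}"
  have "continuous_on {0..t} (work R j)"
    unfolding work_def
    using indefinite_integral_continuous_1[OF unit_rate_integrable[OF assms(1) order_refl]] .
  then have "closed ?X"
    by (intro continuous_on_closed_Collect_le) auto
  moreover have "bounded ?X" by (rule bounded_subset[of "{0..t}"]) auto
  ultimately have "compact ?X" by (simp add: compact_eq_bounded_closed)
  moreover have "?X \<noteq> {}" using assms by auto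
  ultimately obtain C where C: "C \<in> ?X" "\<forall>s\<in>?X. C \<le> s"
    using compact_attains_inf by blast
  have "completes_at p R j C"
    unfolding completes_at_def
  proof (intro conjI allI impI)
    fix s assume "0 \<le> s \<and> p j \<le> work R j s"
    then show "C \<le> s" using C by (cases "s \<le> t") auto
  qed (use C in auto)
  then show ?thesis using that C by auto
qed

lemma completion_time_eq: "completes_at p R j C \<Longrightarrow> completion_time p R j = C"
  unfolding completion_time_def completes_at_def by (intro Least_equality) auto

lemma work_less_iff:
  assumes "unit_rate R j" "completes_at p R j C" "0 \<le> t"
  shows "work R j t < p j \<longleftrightarrow> t < C"
  using assms work_increment(1)[OF assms(1), of C t] unfolding completes_at_def
  by (metis linorder_not_le order.trans)

section \<open>Properties of arbitrary schedules\<close>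

context
  fixes n m :: nat and p :: "nat \<Rightarrow> real" and A :: "(nat \<times> nat) set" and R :: "nat \<Rightarrow> real \<Rightarrow> real"
  assumes sched: "schedule n m p A R"
begin

lemma schedule_unit_rate: "j \<in> {1..n} \<Longrightarrow> unit_rate R j"
  using sched by (simp add: schedule_def unit_rate_def)

lemma schedule_completes_at:
  assumes "j \<in> {1..n}"
  shows "completes_at p R j (completion_time p R j)"
proof -
  have "\<forall>j\<in>{1..n}. \<exists>t\<ge>0. p j \<le> work R j t" using sched by (simp add: schedule_def)
  then obtain t where "0 \<le> t" "p j \<le> work R j t" using assms by blast
  then obtain C where "completes_at p R j C"
    using completes_at_exists[OF schedule_unit_rate[OF assms]] by blast
  then show ?thesis using completion_time_eq by metis
qed

lemma schedule_completion_nonneg: "j \<in> {1..n} \<Longrightarrow> 0 \<le> completion_time p R j"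
  using schedule_completes_at by (auto simp: completes_at_def)

lemma schedule_unfinished_iff:
  assumes "j \<in> {1..n}" "0 \<le> t"
  shows "j \<in> unfinished n p R t \<longleftrightarrow> t < completion_time p R j"
  using work_less_iff[OF schedule_unit_rate[OF assms(1)] schedule_completes_at[OF assms(1)] assms(2)] assms(1)
  by (simp add: unfinished_def)

lemma schedule_rate_zero:
  assumes "j \<in> {1..n}" "0 \<le> t" "j \<notin> available A (unfinished n p R t)"
  shows "R j t = 0"
  using sched assms unfolding schedule_def by (metis order_antisym_conv not_le)

text \<open>Work stays below \<open>p j\<close> before completion, cannot jump at completion, and
  does not grow afterwards because the rate is zero.\<close>

lemma schedule_work_le:
  assumes j: "j \<in> {1..n}" and "0 \<le> p j" "0 \<le> t"
  shows "work R j t \<le> p j"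
proof -
  define C where "C = completion_time p R j"
  note unit = schedule_unit_rate[OF j]
  have C: "completes_at p R j C" "0 \<le> C"
    using schedule_completes_at[OF j] schedule_completion_nonneg[OF j] by (auto simp: C_def)
  have "work R j C \<le> p j"
  proof (cases "C = 0")
    case False
    show ?thesis
    proof (rule field_le_epsilon)
      \<comment> \<open>At a time at most \<open>e\<close> before completion less than
        \<open>p j\<close> has been done, and the rest adds at most \<open>e\<close>; the maximum
        with \<open>0\<close> keeps that time nonnegative.\<close>
      fix e :: real assume "0 < e"
      define s where "s = max 0 (C - e)"
      have s: "0 \<le> s" "s < C" "C - s \<le> e" using False C(2) \<open>0 < e\<close> by (auto simp: s_def)
      then have "work R j s < p j" using work_less_iff[OF unit C(1)] by simp
      then show "work R j C \<le> p j + e" using work_increment(2)[OF unit, of s C] s by simp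
    qed
  qed (use assms in simp)
  moreover have "work R j t \<le> work R j C"
  proof (cases "t \<le> C")
    case True
    then show ?thesis using work_increment(1)[OF unit] assms by simp
  next
    case False
    have "R j s = 0" if "s \<in> {C..t}" for s
      using schedule_rate_zero[OF j, of s] schedule_unfinished_iff[OF j, of s] available_subset that C(2)
      by (fastforce simp: C_def)
    then have "integral {C..t} (R j) = integral {C..t} (\<lambda>_. 0)"
      by (rule integral_cong)
    then show ?thesis using work_split[OF unit C(2), of t] False by simp
  qed
  ultimately show ?thesis by simp
qed

lemma schedule_total_work_le:
  assumes "0 \<le> t"
  shows "(\<Sum>j = 1..n. work R j t) \<le> real m * t"
proof -
  have int: "R j integrable_on {0..t}" if "j \<in> {1..n}" for j
    using schedule_unit_rate[OF that] assms by (simp add: unit_rate_def)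
  have "(\<Sum>j = 1..n. work R j t) = integral {0..t} (\<lambda>s. \<Sum>j = 1..n. R j s)"
    unfolding work_def using int by (subst integral_sum) auto
  also have "\<dots> \<le> integral {0..t} (\<lambda>_. real m)"
    using int sched by (intro integral_le integrable_sum) (auto simp: schedule_def)
  also have "\<dots> = real m * t" using assms by simp
  finally show ?thesis .
qed

text \<open>The jobs counted are fully processed when \<open>j\<close> completes, and by then
  \<open>m\<close> machines have delivered at most \<open>m\<close> times the elapsed time.\<close>

lemma schedule_load_bound:
  assumes p: "\<And>k. k \<in> {1..n} \<Longrightarrow> 0 \<le> p k" and j: "j \<in> {1..n}"
  shows "(\<Sum>k\<in>{k\<in>{1..n}. completion_time p R k \<le> completion_time p R j}. p k)
    \<le> real m * completion_time p R j" (is "sum p ?K \<le> _")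
proof -
  let ?C = "completion_time p R j"
  have C0: "0 \<le> ?C" using schedule_completion_nonneg[OF j] .
  have "sum p ?K \<le> (\<Sum>k\<in>?K. work R k ?C)"
  proof (rule sum_mono)
    fix k assume "k \<in> ?K"
    then show "p k \<le> work R k ?C"
      using schedule_completes_at[of k] work_increment(1)[OF schedule_unit_rate, of k "completion_time p R k" ?C]
      by (auto simp: completes_at_def)
  qed
  also have "\<dots> \<le> (\<Sum>k = 1..n. work R k ?C)"
  proof (rule sum_mono2)
    fix k assume "k \<in> {1..n} - ?K"
    then show "0 \<le> work R k ?C"
      using work_increment(1)[OF schedule_unit_rate, of k 0 ?C] C0 by simp
  qed auto
  also have "\<dots> \<le> real m * ?C" using schedule_total_work_le[OF C0] .
  finally show ?thesis .
qed

text \<open>Job \<open>j\<close> idles until \<open>k\<close> completes and then proceeds at rate at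
  most one. Positivity of \<open>p j\<close> matters: a job of length zero completes at time
  \<open>0\<close>, whatever its predecessors do.\<close>

lemma schedule_precedence:
  assumes kj: "(k, j) \<in> A" "k \<in> {1..n}" "j \<in> {1..n}" and "0 < p j"
  shows "completion_time p R k + p j \<le> completion_time p R j"
proof -
  let ?C = "completion_time p R"
  note unit = schedule_unit_rate[OF kj(3)]
  have C: "0 \<le> ?C k" "0 \<le> ?C j" using kj schedule_completion_nonneg by auto
  have pj: "p j \<le> work R j (?C j)" using schedule_completes_at[OF kj(3)] by (simp add: completes_at_def)
  have idle: "R j s = 0" if "0 \<le> s" "s < ?C k" for s
    using that schedule_rate_zero[OF kj(3), of s] schedule_unfinished_iff[OF kj(2), of s] kj(1)
    by (auto simp: available_def)
  have zero: "work R j (?C k) = 0"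
  proof -
    \<comment> \<open>The rate may already be positive at the single point
      \<open>?C k\<close>.\<close>
    have "(R j has_integral 0) {0..?C k}"
      by (rule has_integral_spike_finite[of "{?C k}" _ _ "\<lambda>_. 0"]) (use idle in auto)
    then show ?thesis by (simp add: work_def integral_unique)
  qed
  have le: "?C k \<le> ?C j"
  proof (rule ccontr)
    assume "\<not> ?C k \<le> ?C j"
    then have "work R j (?C j) \<le> work R j (?C k)" using work_increment(1)[OF unit C(2)] by simp
    then show False using zero pj \<open>0 < p j\<close> by simp
  qed
  show ?thesis using work_increment(2)[OF unit C(1) le] zero pj by simp
qed

lemma schedule_processing_le_completion:
  assumes "j \<in> {1..n}"
  shows "p j \<le> completion_time p R j"
  using work_increment(2)[OF schedule_unit_rate[OF assms] order_refl schedule_completion_nonneg[OF assms]]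
    schedule_completes_at[OF assms] by (simp add: completes_at_def)

end

section \<open>Runs of the policy\<close>

lemma finite_completion_events: "finite (completion_events n p R)"
proof -
  have "completion_events n p R = (\<Union>j\<in>{1..n}. {t. completes_at p R j t})"
    by (auto simp: completion_events_def)
  moreover have "finite {t. completes_at p R j t}" for j
    by (rule finite_subset[of _ "{completion_time p R j}"]) (auto dest: completion_time_eq)
  ultimately show ?thesis by simp
qed

text \<open>The events of a run in increasing order, with the rates \<open>r i\<close> that are used from \<open>\<tau> i\<close> on.
  The interval that starts at \<open>\<tau> q\<close> is unbounded.\<close>

locale policy_run =
  fixes n m :: nat and p w :: "nat \<Rightarrow> real" and A :: "(nat \<times> nat) set" and R :: "nat \<Rightarrow> real \<Rightarrow> real"
    and \<tau> :: "nat \<Rightarrow> real" and q :: nat and r :: "nat \<Rightarrow> nat \<Rightarrow> real"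
  assumes inst: "scheduling_instance n m p w A"
    and \<tau>_0: "\<tau> 0 = 0"
    and \<tau>_less: "\<And>i k. i < k \<Longrightarrow> k \<le> q \<Longrightarrow> \<tau> i < \<tau> k"
    and events: "completion_events n p R \<subseteq> \<tau> ` {..q}"
    and rates: "\<And>i. i \<le> q \<Longrightarrow> computed_rates m w A (unfinished n p R (\<tau> i)) (r i)"
    and R_eq: "\<And>i s j. i \<le> q \<Longrightarrow> \<tau> i \<le> s \<Longrightarrow> (i < q \<Longrightarrow> s < \<tau> (Suc i)) \<Longrightarrow> j \<in> {1..n} \<Longrightarrow> R j s = r i j"

text \<open>The events together with \<open>0\<close> are sorted without repetition. No event lies
  strictly between neighbours, so the rates chosen at one entry stay in force up to, but excluding,
  the next.\<close>

lemma follows_policy_run: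
  assumes inst: "scheduling_instance n m p w A" and pol: "follows_policy n m p w A R"
  obtains \<tau> q r where "policy_run n m p w A R \<tau> q r"
proof -
  let ?Ev = "completion_events n p R"
  define E where "E = {0} \<union> ?Ev"
  have finE: "finite E" using finite_completion_events by (simp add: E_def)
  have E0: "0 \<in> E" "\<And>e. e \<in> E \<Longrightarrow> 0 \<le> e"
    by (auto simp: E_def completion_events_def completes_at_def)
  define xs where "xs = sorted_list_of_set E"
  define q where "q = length xs - 1"
  have xs: "set xs = E" "sorted_wrt (<) xs" using finE by (auto simp: xs_def)
  have len: "length xs = Suc q" using xs(1) E0(1) by (cases xs) (auto simp: q_def)
  have \<tau>_less: "xs ! i < xs ! k" if "i < k" "k \<le> q" for i k
    using sorted_wrt_nth_less[OF xs(2), of i k] that len by simp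
  have range: "E = (!) xs ` {..q}"
    using xs(1) len by (force simp: set_conv_nth less_Suc_eq_le)
  have \<tau>_0: "xs ! 0 = 0"
  proof -
    obtain i where i: "i \<le> q" "xs ! i = 0" using E0(1) range by auto
    moreover have "xs ! 0 \<ge> 0" using E0(2) range by auto
    ultimately show ?thesis using \<tau>_less[of 0 i] by (cases "i = 0") auto
  qed
  have "\<forall>i\<in>{..q}. \<exists>\<rho>. computed_rates m w A (unfinished n p R (xs ! i)) \<rho> \<and>
      (\<forall>s\<ge>xs ! i. {xs ! i<..s} \<inter> ?Ev = {} \<longrightarrow> (\<forall>j\<in>{1..n}. R j s = \<rho> j))"
    using pol range unfolding follows_policy_def E_def by blast
  from bchoice[OF this] obtain r where
    r: "\<forall>i\<in>{..q}. computed_rates m w A (unfinished n p R (xs ! i)) (r i) \<and>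
      (\<forall>s\<ge>xs ! i. {xs ! i<..s} \<inter> ?Ev = {} \<longrightarrow> (\<forall>j\<in>{1..n}. R j s = r i j))"
    by blast
  have "policy_run n m p w A R ((!) xs) q r"
  proof
    show "?Ev \<subseteq> (!) xs ` {..q}" using range by (auto simp: E_def)
    show "R j s = r i j"
      if "i \<le> q" "xs ! i \<le> s" "i < q \<Longrightarrow> s < xs ! Suc i" "j \<in> {1..n}" for i s j
    proof -
      have "{xs ! i<..s} \<inter> ?Ev = {}"
      proof (rule ccontr)
        assume "{xs ! i<..s} \<inter> ?Ev \<noteq> {}"
        then obtain e where e: "e \<in> ?Ev" "xs ! i < e" "e \<le> s" by auto
        then have "e \<in> (!) xs ` {..q}" unfolding range[symmetric] E_def by simp
        with e obtain k where k: "k \<le> q" "xs ! i < xs ! k" "xs ! k \<le> s" by auto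
        have "i < k" using k \<tau>_less[of k i] that(1) by (cases i k rule: linorder_cases) auto
        then have "xs ! Suc i \<le> xs ! k" using \<tau>_less[of "Suc i" k] k(1) by (cases "Suc i = k") auto
        then show False using that(3) \<open>i < k\<close> k by auto
      qed
      then show ?thesis using r that(1,2,4) by auto
    qed
    show "computed_rates m w A (unfinished n p R (xs ! i)) (r i)" if "i \<le> q" for i
      using r that by simp
  qed (fact inst \<tau>_0 \<tau>_less)+
  then show ?thesis using that by blast
qed

section \<open>A run of the policy is a schedule\<close>

context policy_run
begin

abbreviation U :: "nat \<Rightarrow> nat set" where "U i \<equiv> unfinished n p R (\<tau> i)"

abbreviation \<Delta> :: "nat \<Rightarrow> real" where "\<Delta> i \<equiv> \<tau> (Suc i) - \<tau> i"

lemma finite_U: "finite (U i)"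
  by (simp add: unfinished_def)

lemma p_nonneg: "j \<in> {1..n} \<Longrightarrow> 0 \<le> p j" and w_nonneg: "j \<in> {1..n} \<Longrightarrow> 0 \<le> w j"
  and A_subset: "A \<subseteq> {1..n} \<times> {1..n}" and acyclic_A: "acyclic A" and m_pos: "m \<ge> 1"
  using inst by (auto simp: scheduling_instance_def)

lemma \<tau>_mono: "i \<le> k \<Longrightarrow> k \<le> q \<Longrightarrow> \<tau> i \<le> \<tau> k"
  using \<tau>_less[of i k] by (cases "i = k") auto

lemma \<tau>_nonneg: "i \<le> q \<Longrightarrow> 0 \<le> \<tau> i"
  using \<tau>_mono[of 0 i] \<tau>_0 by simp

lemma \<Delta>_pos: "i < q \<Longrightarrow> 0 < \<Delta> i"
  using \<tau>_less[of i "Suc i"] by simp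

lemma interval_exists:
  assumes "0 \<le> s"
  obtains i where "i \<le> q" "\<tau> i \<le> s" "i < q \<Longrightarrow> s < \<tau> (Suc i)"
proof -
  let ?I = "{i. i \<le> q \<and> \<tau> i \<le> s}"
  have fin: "finite ?I" by simp
  have "0 \<in> ?I" using assms \<tau>_0 by simp
  then have max: "Max ?I \<in> ?I" using Max_in[OF fin] by blast
  have "s < \<tau> (Suc (Max ?I))" if "Max ?I < q"
  proof (rule ccontr)
    assume "\<not> s < \<tau> (Suc (Max ?I))"
    then have "Suc (Max ?I) \<in> ?I" using that by simp
    then show False using Max_ge[OF fin] by fastforce
  qed
  then show ?thesis using that max by blast
qed

lemma r_bounds: "i \<le> q \<Longrightarrow> 0 \<le> r i j" "i \<le> q \<Longrightarrow> r i j \<le> 1"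
  using computed_rates_bounds[OF finite_U rates] by auto

lemma r_zero: "i \<le> q \<Longrightarrow> j \<notin> available A (U i) \<Longrightarrow> r i j = 0"
  using rates by (auto simp: computed_rates_def)

lemma has_integral_R:
  assumes j: "j \<in> {1..n}" and "a \<le> q"
  shows "(R j has_integral (\<Sum>i<a. \<Delta> i * r i j)) {0..\<tau> a}"
  using assms(2)
proof (induction a)
  case 0
  then show ?case by (simp add: \<tau>_0 has_integral_refl)
next
  case (Suc a)
  have "((\<lambda>_. r a j) has_integral \<Delta> a * r a j) {\<tau> a..\<tau> (Suc a)}"
    using has_integral_const_real[of "r a j" "\<tau> a" "\<tau> (Suc a)"] \<Delta>_pos[of a] Suc.prems by simp
  then have "(R j has_integral \<Delta> a * r a j) {\<tau> a..\<tau> (Suc a)}"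
    \<comment> \<open>At its right endpoint the interval already carries the next rates.\<close>
    by (rule has_integral_spike_finite[of "{\<tau> (Suc a)}", rotated 2]) (use R_eq[of a _ j] j Suc.prems in auto)
  then have "(R j has_integral (\<Sum>i<a. \<Delta> i * r i j) + \<Delta> a * r a j) {0..\<tau> (Suc a)}"
    using Suc \<tau>_nonneg[of a] \<tau>_mono[of a "Suc a"]
    by (intro has_integral_combine[of 0 "\<tau> a"]) auto
  then show ?case by simp
qed

lemma R_unit_rate:
  assumes j: "j \<in> {1..n}"
  shows "unit_rate R j"
  unfolding unit_rate_def
proof (intro allI impI conjI)
  fix t :: real assume t: "0 \<le> t"
  let ?b = "max t (\<tau> q)"
  have left: "R j integrable_on {0..\<tau> q}" using has_integral_R[OF j order_refl] by blast
  have right: "R j integrable_on {\<tau> q..?b}"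
    by (rule integrable_eq[of "\<lambda>_. r q j"]) (use R_eq[of q] j in auto)
  have "R j integrable_on {0..?b}"
    by (rule Henstock_Kurzweil_Integration.integrable_combine[OF \<tau>_nonneg[OF order_refl] _ left right]) simp
  then show "R j integrable_on {0..t}" by (rule integrable_on_subinterval) auto
  obtain i where "i \<le> q" "\<tau> i \<le> t" "i < q \<Longrightarrow> t < \<tau> (Suc i)" using interval_exists[OF t] by blast
  then show "0 \<le> R j t" "R j t \<le> 1" using R_eq[of i t j] j r_bounds[of i j] by auto
qed

lemma work_eq: "j \<in> {1..n} \<Longrightarrow> a \<le> q \<Longrightarrow> work R j (\<tau> a) = (\<Sum>i<a. \<Delta> i * r i j)"
  using has_integral_R by (simp add: work_def integral_unique)

lemma completes_at_event:
  assumes "j \<in> {1..n}" "completes_at p R j C"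
  obtains k where "k \<le> q" "C = \<tau> k"
proof -
  have "C \<in> completion_events n p R" using assms unfolding completion_events_def by blast
  then show ?thesis using events that by auto
qed

text \<open>A job finishing inside the interval would make its completion time an event there, but
  all events are among the \<open>\<tau> k\<close>.\<close>

lemma unfinished_constant:
  assumes i: "i \<le> q" "\<tau> i \<le> s" "i < q \<Longrightarrow> s < \<tau> (Suc i)"
  shows "unfinished n p R s = U i"
proof -
  have "work R j s < p j \<longleftrightarrow> work R j (\<tau> i) < p j" if j: "j \<in> {1..n}" for j
  proof
    show "work R j (\<tau> i) < p j" if "work R j s < p j"
      using work_increment(1)[OF R_unit_rate[OF j] \<tau>_nonneg[OF i(1)] i(2)] that by simp
    show "work R j s < p j" if less: "work R j (\<tau> i) < p j"
    proof (rule ccontr)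
      assume "\<not> work R j s < p j"
      then obtain C where C: "C \<le> s" "completes_at p R j C"
        using completes_at_exists[OF R_unit_rate[OF j], of s p] \<tau>_nonneg[OF i(1)] i(2) by auto
      have "\<tau> i < C" using work_less_iff[OF R_unit_rate[OF j] C(2) \<tau>_nonneg[OF i(1)]] less by simp
      obtain k where k: "k \<le> q" "C = \<tau> k" using completes_at_event[OF j C(2)] by blast
      then have "i < k" using \<open>\<tau> i < C\<close> \<tau>_mono[of k i] i(1) by (cases "i < k") auto
      then show False using i(3) k C(1) \<tau>_mono[of "Suc i" k] by auto
    qed
  qed
  then show ?thesis by (auto simp: unfinished_def)
qed

lemma available_nonempty:
  assumes "U i \<noteq> {}"
  shows "available A (U i) \<noteq> {}"
proof -
  have "finite A" using A_subset finite_subset by blast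
  then have "wf A" using acyclic_A by (simp add: finite_acyclic_wf)
  then obtain j where "j \<in> U i" "\<And>k. (k, j) \<in> A \<Longrightarrow> k \<notin> U i"
    using assms by (metis ex_in_conv wf_eq_minimal)
  then show ?thesis by (auto simp: available_def)
qed

text \<open>Otherwise some job keeps a positive rate forever after \<open>\<tau> q\<close> and
  finishes, although the set of unfinished jobs is constant from then on.\<close>

lemma all_finished: "U q = {}"
proof (rule ccontr)
  assume "U q \<noteq> {}"
  then have F: "available A (U q) \<noteq> {}" by (rule available_nonempty)
  have finF: "finite (available A (U q))" using finite_U available_subset finite_subset by metis
  have "0 < (\<Sum>j\<in>available A (U q). r q j)"
    using computed_rates_bounds(3)[OF finite_U rates[OF order_refl]] m_pos F finF
    by (simp add: card_gt_0_iff)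
  then obtain j where jF: "j \<in> available A (U q)" and pos: "0 < r q j"
    using sum_nonpos[of "available A (U q)" "r q"] by (meson not_le)
  then have jU: "j \<in> U q" using available_subset by blast
  then have j: "j \<in> {1..n}" by (simp add: unfinished_def)
  note unit = R_unit_rate[OF j]
  \<comment> \<open>By this time the constant rate has delivered all of \<open>p j\<close>.\<close>
  define s where "s = \<tau> q + \<bar>p j\<bar> / r q j"
  have s: "\<tau> q \<le> s" using pos by (simp add: s_def)
  have "integral {\<tau> q..s} (R j) = integral {\<tau> q..s} (\<lambda>_. r q j)"
    using R_eq[of q _ j] j by (intro integral_cong) auto
  also have "\<dots> = \<bar>p j\<bar>" using pos s by (simp add: s_def)
  finally have "p j \<le> work R j s"
    using work_split[OF unit \<tau>_nonneg[OF order_refl] s] work_increment(1)[OF unit order_refl \<tau>_nonneg[OF order_refl]]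
    by simp
  then have "j \<notin> unfinished n p R s" by (simp add: unfinished_def)
  then show False using unfinished_constant[OF order_refl s] jU by simp
qed

lemma is_schedule: "schedule n m p A R"
  unfolding schedule_def
proof (intro conjI ballI allI impI)
  fix j assume j: "j \<in> {1..n}"
  show "\<exists>t\<ge>0. p j \<le> work R j t"
    using all_finished \<tau>_nonneg[OF order_refl] j by (fastforce simp: unfinished_def)
  fix t :: real assume t: "0 \<le> t"
  show "R j integrable_on {0..t}" "0 \<le> R j t" "R j t \<le> 1"
    using R_unit_rate[OF j] t by (auto simp: unit_rate_def)
  assume pos: "0 < R j t"
  obtain i where i: "i \<le> q" "\<tau> i \<le> t" "i < q \<Longrightarrow> t < \<tau> (Suc i)" using interval_exists[OF t] by blast
  then show "j \<in> available A (unfinished n p R t)"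
    using R_eq[OF i j] unfinished_constant[OF i] r_zero[OF i(1), of j] pos by fastforce
next
  fix t :: real assume t: "0 \<le> t"
  obtain i where i: "i \<le> q" "\<tau> i \<le> t" "i < q \<Longrightarrow> t < \<tau> (Suc i)" using interval_exists[OF t] by blast
  have "(\<Sum>j = 1..n. R j t) = (\<Sum>j = 1..n. r i j)" using R_eq[OF i] by simp
  also have "\<dots> = (\<Sum>j\<in>available A (U i). r i j)"
    using r_zero[OF i(1)] by (intro sum.mono_neutral_right) (auto simp: available_def unfinished_def)
  also have "\<dots> \<le> real m" using computed_rates_bounds(3)[OF finite_U rates[OF i(1)]] by simp
  finally show "(\<Sum>j = 1..n. R j t) \<le> real m" .
qed

section \<open>Cost of a run against an arbitrary schedule\<close>

lemma U_iff: "j \<in> {1..n} \<Longrightarrow> i \<le> q \<Longrightarrow> j \<in> U i \<longleftrightarrow> \<tau> i < completion_time p R j"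
  using schedule_unfinished_iff[OF is_schedule] \<tau>_nonneg by blast

text \<open>The job is unfinished in exactly the intervals before its completion event, and their
  lengths telescope. This turns the objective into the integral of the unfinished weight.\<close>

lemma completion_time_sum:
  assumes j: "j \<in> {1..n}"
  shows "completion_time p R j = (\<Sum>i<q. \<Delta> i * of_bool (j \<in> U i))"
proof -
  obtain a where a: "a \<le> q" "completion_time p R j = \<tau> a"
    using completes_at_event[OF j schedule_completes_at[OF is_schedule j]] by blast
  have "j \<in> U i \<longleftrightarrow> i < a" if "i < q" for i
    using U_iff[OF j, of i] a that \<tau>_less[of i a] \<tau>_mono[of a i] by (cases "i < a") auto
  then have "(\<Sum>i<q. \<Delta> i * of_bool (j \<in> U i)) = (\<Sum>i<q. if i \<in> {..<a} then \<Delta> i else 0)"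
    by (intro sum.cong) auto
  also have "\<dots> = (\<Sum>i\<in>{..<q} \<inter> {..<a}. \<Delta> i)" by (rule sum.inter_restrict[symmetric]) simp
  also have "{..<q} \<inter> {..<a} = {..<a}" using a(1) by auto
  also have "(\<Sum>i<a. \<Delta> i) = \<tau> a" by (simp add: sum_lessThan_telescope \<tau>_0)
  finally show ?thesis using a(2) by simp
qed

lemma total_rates_le: "j \<in> {1..n} \<Longrightarrow> (\<Sum>i<q. \<Delta> i * r i j) \<le> p j"
  using schedule_work_le[OF is_schedule, of j "\<tau> q"] p_nonneg \<tau>_nonneg[of q] work_eq[of j q] by simp

text \<open>Outside the sets \<open>T i\<close>, a job waits only for the predecessor that the algorithm finishes last
  (to which the same bound applies, since that one is outside \<open>T i\<close> as well) or runs at full speed.\<close>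

lemma time_outside_closed_sets_le:
  assumes S: "schedule n m p A S"
    and T: "\<And>i. i < q \<Longrightarrow> successor_closed A (U i) (T i)"
    and full: "\<And>i j. i < q \<Longrightarrow> j \<in> available A (U i) - T i \<Longrightarrow> r i j = 1"
    and "j \<in> {1..n}"
  shows "(\<Sum>i<q. \<Delta> i * of_bool (j \<in> U i - T i)) \<le> completion_time p S j"
proof -
  have "finite A" using A_subset finite_subset by blast
  then have "wf A" using acyclic_A by (simp add: finite_acyclic_wf)
  then show ?thesis using \<open>j \<in> {1..n}\<close>
  proof (induction j rule: wf_induct_rule)
    case (less j)
    note j = \<open>j \<in> {1..n}\<close>
    have running: "\<Delta> i * of_bool (j \<in> U i - T i) \<le> \<Delta> i * r i j"
      if "i < q" "j \<in> U i \<Longrightarrow> j \<in> available A (U i)" for i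
    proof (cases "j \<in> U i - T i")
      case True
      then show ?thesis using full[of i j] that by simp
    next
      case False
      then have "of_bool (j \<in> U i - T i) = (0::real)" by (simp only: of_bool_eq_0_iff not_False_eq_True)
      then show ?thesis using \<Delta>_pos[OF that(1)] r_bounds(1)[of i j] that(1)
        by (simp only: mult_zero_right) simp
    qed
    show ?case
    proof (cases "0 < p j")
      case False
      have "j \<notin> U i" if "i < q" for i
        using work_increment(1)[OF R_unit_rate[OF j] order_refl \<tau>_nonneg[of i]] that False
        by (simp add: unfinished_def)
      then have "(\<Sum>i<q. \<Delta> i * of_bool (j \<in> U i - T i)) = 0" by (intro sum.neutral) auto
      then show ?thesis using schedule_completion_nonneg[OF S j] by simp
    next
      case pj: True
      let ?K = "{k. (k, j) \<in> A}"
      show ?thesis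
      proof (cases "?K = {}")
        case True
        have "(\<Sum>i<q. \<Delta> i * of_bool (j \<in> U i - T i)) \<le> (\<Sum>i<q. \<Delta> i * r i j)"
          using True by (intro sum_mono running) (auto simp: available_def)
        also have "\<dots> \<le> p j" by (rule total_rates_le[OF j])
        also have "\<dots> \<le> completion_time p S j" by (rule schedule_processing_le_completion[OF S j])
        finally show ?thesis .
      next
        case False
        \<comment> \<open>The predecessor \<open>k\<close> is the last one to finish in
          \<open>R\<close>, so that \<open>j\<close> is available as soon as \<open>k\<close> is
          done. In \<open>S\<close> the final estimate holds for every predecessor.\<close>
        have "finite ?K" by (rule finite_subset[of _ "{1..n}"]) (use A_subset in auto)
        then have "Max (completion_time p R ` ?K) \<in> completion_time p R ` ?K"
          using False by (intro Max_in) auto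
        then obtain k where k: "(k, j) \<in> A" "completion_time p R k = Max (completion_time p R ` ?K)"
          by auto
        then have last: "completion_time p R l \<le> completion_time p R k" if "(l, j) \<in> A" for l
          using that \<open>finite ?K\<close> by simp
        have kn: "k \<in> {1..n}" using k(1) A_subset by auto
        have "\<Delta> i * of_bool (j \<in> U i - T i) \<le> \<Delta> i * of_bool (k \<in> U i - T i) + \<Delta> i * r i j"
          if i: "i < q" for i
        proof (cases "k \<in> U i")
          case True
          \<comment> \<open>If \<open>k\<close> were in \<open>T i\<close>, closedness would put its
            successor \<open>j\<close> there too.\<close>
          then have "j \<in> U i - T i \<longrightarrow> k \<in> U i - T i"
            using T[OF i] k(1) by (auto simp: successor_closed_def)
          then show ?thesis
            using \<Delta>_pos[OF i] r_bounds(1)[of i j] i by (auto simp: of_bool_def)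
        next
          case False
          have "l \<notin> U i" if l: "(l, j) \<in> A" for l
          proof -
            have "l \<in> {1..n}" using l A_subset by auto
            then show ?thesis using False last[OF l] U_iff[OF kn, of i] U_iff[of l i] i by simp
          qed
          then have "\<Delta> i * of_bool (j \<in> U i - T i) \<le> \<Delta> i * r i j"
            using i by (intro running) (auto simp: available_def)
          then show ?thesis using False by simp
        qed
        then have "(\<Sum>i<q. \<Delta> i * of_bool (j \<in> U i - T i)) \<le>
            (\<Sum>i<q. \<Delta> i * of_bool (k \<in> U i - T i)) + (\<Sum>i<q. \<Delta> i * r i j)"
          unfolding sum.distrib[symmetric] by (intro sum_mono) simp
        also have "\<dots> \<le> completion_time p S k + p j"
          using less.IH[OF k(1) kn] total_rates_le[OF j] by (rule add_mono)
        also have "\<dots> \<le> completion_time p S j"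
          using schedule_precedence[OF S k(1) kn j pj] .
        finally show ?thesis .
      qed
    qed
  qed
qed

text \<open>Over time job \<open>k\<close> receives at most \<open>p k\<close>, which bounds the sum
  by \<open>p k * w j\<close> over pairs with \<open>k\<close> not after \<open>j\<close> in
  \<open>S\<close>. Grouped by \<open>j\<close>, the processing times are a load that
  \<open>S\<close> has finished when \<open>j\<close> completes, hence at most \<open>m\<close>
  times that completion time.\<close>

lemma weight_of_tight_sets_le:
  assumes S: "schedule n m p A S"
    and T: "\<And>i. i < q \<Longrightarrow> real m * sum w (T i) \<le>
      2 * (\<Sum>k\<in>available A (U i). r i k * sum w {j\<in>U i. completion_time p S k \<le> completion_time p S j})"
  shows "(\<Sum>i<q. \<Delta> i * sum w (T i)) \<le> 2 * total_weighted_completion_time n p w S"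
proof -
  let ?N = "{1..n}" and ?c = "completion_time p S"
  \<comment> \<open>Taking all jobs instead of \<open>U i\<close> makes the weight independent of
    \<open>i\<close>, so that the rates of \<open>k\<close> can be summed over time.\<close>
  define W where "W k = sum w {j\<in>?N. ?c k \<le> ?c j}" for k
  have W_ge: "sum w {j\<in>U i. ?c k \<le> ?c j} \<le> W k" for i k
    unfolding W_def
  proof (rule sum_mono2)
    show "{j\<in>U i. ?c k \<le> ?c j} \<subseteq> {j\<in>?N. ?c k \<le> ?c j}" by (auto simp: unfinished_def)
  qed (use w_nonneg in auto)
  have W_nonneg: "0 \<le> W k" for k
    unfolding W_def using w_nonneg by (intro sum_nonneg) auto
  have step: "real m * (\<Delta> i * sum w (T i)) \<le> 2 * (\<Sum>k\<in>?N. \<Delta> i * r i k * W k)" if i: "i < q" for i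
  proof -
    have "(\<Sum>k\<in>available A (U i). r i k * sum w {j\<in>U i. ?c k \<le> ?c j}) \<le>
        (\<Sum>k\<in>available A (U i). r i k * W k)"
      using i r_bounds(1)[of i] W_ge by (intro sum_mono mult_left_mono) auto
    also have "\<dots> = (\<Sum>k\<in>?N. r i k * W k)"
      using r_zero[of i] i by (intro sum.mono_neutral_left) (auto simp: available_def unfinished_def)
    finally have "real m * sum w (T i) \<le> 2 * (\<Sum>k\<in>?N. r i k * W k)" using T[OF i] by simp
    then have "\<Delta> i * (real m * sum w (T i)) \<le> \<Delta> i * (2 * (\<Sum>k\<in>?N. r i k * W k))"
      using \<Delta>_pos[OF i] by (intro mult_left_mono) auto
    moreover have "(\<Sum>k\<in>?N. \<Delta> i * r i k * W k) = \<Delta> i * (\<Sum>k\<in>?N. r i k * W k)"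
      by (simp add: sum_distrib_left mult.assoc)
    ultimately show ?thesis by (simp only: mult.left_commute)
  qed
  have "real m * (\<Sum>i<q. \<Delta> i * sum w (T i)) \<le> (\<Sum>i<q. 2 * (\<Sum>k\<in>?N. \<Delta> i * r i k * W k))"
    unfolding sum_distrib_left[of "real m"] using step by (intro sum_mono) simp
  also have "\<dots> = 2 * (\<Sum>k\<in>?N. (\<Sum>i<q. \<Delta> i * r i k) * W k)"
    unfolding sum_distrib_left[symmetric] sum_distrib_right by (subst sum.swap) simp
  also have "\<dots> \<le> 2 * (\<Sum>k\<in>?N. p k * W k)"
    using total_rates_le W_nonneg by (intro mult_left_mono sum_mono mult_right_mono) auto
  also have "(\<Sum>k\<in>?N. p k * W k) = (\<Sum>k\<in>?N. \<Sum>j\<in>{j\<in>?N. ?c k \<le> ?c j}. p k * w j)"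
    by (simp add: W_def sum_distrib_left)
  also have "\<dots> = (\<Sum>j\<in>?N. \<Sum>k\<in>{k\<in>?N. ?c k \<le> ?c j}. p k * w j)"
    by (rule sum.swap_restrict) auto
  also have "\<dots> = (\<Sum>j\<in>?N. w j * sum p {k\<in>?N. ?c k \<le> ?c j})"
    by (simp add: sum_distrib_left mult.commute)
  also have "2 * \<dots> \<le> 2 * (\<Sum>j\<in>?N. w j * (real m * ?c j))"
    using schedule_load_bound[OF S p_nonneg] w_nonneg
    by (intro mult_left_mono sum_mono) auto
  also have "\<dots> = real m * (2 * total_weighted_completion_time n p w S)"
    by (simp add: total_weighted_completion_time_def sum_distrib_left mult_ac)
  finally show ?thesis using m_pos by simp
qed

lemma competitive:
  assumes S: "schedule n m p A S"
  shows "total_weighted_completion_time n p w R \<le> 3 * total_weighted_completion_time n p w S"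
proof -
  let ?N = "{1..n}" and ?c = "completion_time p S"
  \<comment> \<open>The restriction to unfinished jobs ensures positive length, without which a
    successor could complete first in \<open>S\<close>.\<close>
  have c_mono: "?c j \<le> ?c k" if "(j, k) \<in> A" "j \<in> U i" "k \<in> U i" "i < q" for i j k
  proof -
    have jk: "j \<in> ?N" "k \<in> ?N" using that by (auto simp: unfinished_def)
    have "0 < p k"
      using that(3,4) work_increment(1)[OF R_unit_rate[OF jk(2)] order_refl \<tau>_nonneg[of i]]
      by (simp add: unfinished_def)
    then show ?thesis using schedule_precedence[OF S that(1) jk] by simp
  qed
  have "\<exists>T. successor_closed A (U i) T \<and> (\<forall>j\<in>available A (U i) - T. r i j = 1) \<and>
      real m * sum w T \<le> 2 * (\<Sum>k\<in>available A (U i). r i k * sum w {j\<in>U i. ?c k \<le> ?c j})"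
    if i: "i < q" for i
  proof -
    have w: "0 \<le> w j" if "j \<in> U i" for j using that w_nonneg by (simp add: unfinished_def)
    have "computed_rates m w A (U i) (r i)" using rates i by simp
    show ?thesis
    proof (rule computed_rates_tight_set[OF finite_U w \<open>computed_rates m w A (U i) (r i)\<close>])
      fix T
      assume "successor_closed A (U i) T" "\<And>j. j \<in> available A (U i) - T \<Longrightarrow> r i j = 1"
        and le: "\<And>c :: nat \<Rightarrow> real. (\<And>j k. (j, k) \<in> A \<Longrightarrow> j \<in> U i \<Longrightarrow> k \<in> U i \<Longrightarrow> c j \<le> c k) \<Longrightarrow>
          real m * sum w T \<le> 2 * (\<Sum>k\<in>available A (U i). r i k * sum w {j\<in>U i. c k \<le> c j})"
      moreover have "real m * sum w T \<le>
          2 * (\<Sum>k\<in>available A (U i). r i k * sum w {j\<in>U i. ?c k \<le> ?c j})"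
        by (rule le) (rule c_mono[OF _ _ _ i])
      ultimately show ?thesis by blast
    qed
  qed
  then have "\<forall>i. \<exists>T. i < q \<longrightarrow> successor_closed A (U i) T \<and> (\<forall>j\<in>available A (U i) - T. r i j = 1) \<and>
      real m * sum w T \<le> 2 * (\<Sum>k\<in>available A (U i). r i k * sum w {j\<in>U i. ?c k \<le> ?c j})"
    by blast
  from choice[OF this] obtain T where T: "\<And>i. i < q \<Longrightarrow> successor_closed A (U i) (T i)"
    "\<And>i j. i < q \<Longrightarrow> j \<in> available A (U i) - T i \<Longrightarrow> r i j = 1"
    "\<And>i. i < q \<Longrightarrow> real m * sum w (T i) \<le>
      2 * (\<Sum>k\<in>available A (U i). r i k * sum w {j\<in>U i. ?c k \<le> ?c j})"
    by blast
  have interval: "sum w (T i) = (\<Sum>j\<in>?N. w j * of_bool (j \<in> T i))" "T i \<subseteq> U i" if "i < q" for i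
  proof -
    show TU: "T i \<subseteq> U i" using T(1)[OF that] by (simp add: successor_closed_def)
    have "T i \<subseteq> ?N" using TU by (auto simp: unfinished_def)
    then show "sum w (T i) = (\<Sum>j\<in>?N. w j * of_bool (j \<in> T i))"
      by (simp add: sum.inter_restrict[symmetric] of_bool_def if_distrib Int_absorb1 cong: if_cong)
  qed
  have "total_weighted_completion_time n p w R = (\<Sum>j\<in>?N. \<Sum>i<q. w j * (\<Delta> i * of_bool (j \<in> U i)))"
    unfolding total_weighted_completion_time_def
    by (intro sum.cong refl) (simp only: completion_time_sum sum_distrib_left)
  \<comment> \<open>The unfinished jobs are split into those outside and those inside
    \<open>T i\<close>.\<close>
  also have "\<dots> = (\<Sum>j\<in>?N. \<Sum>i<q. w j * (\<Delta> i * of_bool (j \<in> U i - T i)) + \<Delta> i * (w j * of_bool (j \<in> T i)))"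
    using interval(2) by (intro sum.cong refl) (auto simp: of_bool_def)
  also have "\<dots> = (\<Sum>j\<in>?N. w j * (\<Sum>i<q. \<Delta> i * of_bool (j \<in> U i - T i))) +
      (\<Sum>j\<in>?N. \<Sum>i<q. \<Delta> i * (w j * of_bool (j \<in> T i)))"
    by (simp only: sum.distrib sum_distrib_left)
  also have "(\<Sum>j\<in>?N. \<Sum>i<q. \<Delta> i * (w j * of_bool (j \<in> T i))) = (\<Sum>i<q. \<Delta> i * sum w (T i))"
    by (subst sum.swap, intro sum.cong refl) (simp only: lessThan_iff interval(1) sum_distrib_left)
  also have "\<dots> \<le> 2 * total_weighted_completion_time n p w S"
    using weight_of_tight_sets_le[OF S T(3)] by simp
  also have "(\<Sum>j\<in>?N. w j * (\<Sum>i<q. \<Delta> i * of_bool (j \<in> U i - T i))) \<le> (\<Sum>j\<in>?N. w j * ?c j)"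
    using time_outside_closed_sets_le[OF S T(1,2)] w_nonneg by (intro sum_mono mult_left_mono) auto
  also have "\<dots> = total_weighted_completion_time n p w S"
    by (simp add: total_weighted_completion_time_def)
  finally show ?thesis by simp
qed

end

text \<open>That \<open>ALG\<close> is a schedule belongs to the conclusion, as following the policy
  only prescribes rates. Comparison with every schedule includes any optimal one.\<close>

theorem theorem2:
  fixes n m :: nat and p w :: "nat \<Rightarrow> real" and A :: "(nat \<times> nat) set"
    and ALG :: "nat \<Rightarrow> real \<Rightarrow> real"
  assumes "scheduling_instance n m p w A"
    and "follows_policy n m p w A ALG"
  shows "schedule n m p A ALG \<and>
    (\<forall>OPT. schedule n m p A OPT \<longrightarrow>
       total_weighted_completion_time n p w ALG \<le> 3 * total_weighted_completion_time n p w OPT)"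
proof -
  obtain \<tau> q r where "policy_run n m p w A ALG \<tau> q r" by (rule follows_policy_run[OF assms])
  then interpret policy_run n m p w A ALG \<tau> q r .
  show ?thesis using is_schedule competitive by blast
qed

end
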